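(* Let $0<r<1$ and let $P_r=\{z\in\mathbb C: r<|z|<1\}$. Then $$\frac{K_{P_r}(\sqrt r)}{(c_{P_r}(\sqrt r))^2}\ge\frac{-2\log r}{\pi^3},$$ where $K_{P_r}$ is the Bergman kernel of $P_r$ on the diagonal and $c_{P_r}(w)$ is the logarithmic capacity of the complement of $P_r$ with respect to $w$.
   Context: $\lambda$ is Lebesgue measure on $\mathbb C\cong\mathbb R^2$. For a domain $\Omega\subset\mathbb C$ and $w\in\Omega$, $$K_\Omega(w)=\sup\Big\{|f(w)|^2: f\in\mathcal O(\Omega),\ \int_\Omega|f|^2\,d\lambda\le1\Big\},$$ $$G_{\Omega,w}=\sup\{u: u\text{ negative subharmonic on }\Omega,\ u\le \log|\cdot-w|+C\text{ near }w\text{ for some constant }C\},$$ $$c_\Omega(w)=\exp\lim_{z\to w}\big(G_{\Omega,w}(z)-\log|z-w|\big).$$ *)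

theory Defs
  imports "HOL-Analysis.Analysis"
begin

(* The supremum is taken in the reals: for open \<Omega> containing w the set contains 0 and is bounded
   above, because point evaluation is bounded on the Bergman space.
   The condition on f uses the nonnegative Lebesgue integral, since the Bochner integral of a
   function that is not integrable is 0. *)
definition bergman_kernel :: "complex set \<Rightarrow> complex \<Rightarrow> real" where
  "bergman_kernel \<Omega> w =
     Sup {(cmod (f w))\<^sup>2 |f. f holomorphic_on \<Omega> \<and>
            (\<integral>\<^sup>+z\<in>\<Omega>. ennreal ((cmod (f z))\<^sup>2) \<partial>lebesgue) \<le> 1}"

(* Mean over the circle of centre a and radius s of a function with values in the extended reals,
   as positive minus negative part.  For u upper semicontinuous and less than \<infinity> on the circle,
   the positive part has finite integral, so that the difference is not of the form
   \<infinity> - \<infinity>. *)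
definition circle_mean :: "(complex \<Rightarrow> ereal) \<Rightarrow> complex \<Rightarrow> real \<Rightarrow> ereal" where
  "circle_mean u a s =
     (enn2ereal (\<integral>\<^sup>+t\<in>{0..2*pi}. e2ennreal (u (a + of_real s * cis t)) \<partial>lborel)
      - enn2ereal (\<integral>\<^sup>+t\<in>{0..2*pi}. e2ennreal (- u (a + of_real s * cis t)) \<partial>lborel))
     / ereal (2*pi)"

(* Upper semicontinuity and the local submean inequality.  The constant -\<infinity> is allowed. *)
definition subharmonic_on :: "(complex \<Rightarrow> ereal) \<Rightarrow> complex set \<Rightarrow> bool" where
  "subharmonic_on u \<Omega> \<longleftrightarrow>
     (\<forall>z\<in>\<Omega>. u z < \<infinity>) \<and>
     (\<forall>c. openin (top_of_set \<Omega>) {z\<in>\<Omega>. u z < c}) \<and>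
     (\<forall>a\<in>\<Omega>. \<exists>\<rho>>0. ball a \<rho> \<subseteq> \<Omega> \<and> (\<forall>s. 0 < s \<and> s < \<rho> \<longrightarrow> u a \<le> circle_mean u a s))"

(* The logarithmic bound is required near w but not at w, because ln 0 = 0; together with the
   submean inequality it gives u w = -\<infinity>. *)
definition green_competitors :: "complex set \<Rightarrow> complex \<Rightarrow> (complex \<Rightarrow> ereal) set" where
  "green_competitors \<Omega> w =
     {u. subharmonic_on u \<Omega> \<and> (\<forall>z\<in>\<Omega>. u z < 0) \<and>
         (\<exists>C::real. \<forall>\<^sub>F z in at w. u z \<le> ereal (ln (cmod (z - w)) + C))}"

definition green_function :: "complex set \<Rightarrow> complex \<Rightarrow> complex \<Rightarrow> ereal" where
  "green_function \<Omega> w z = (SUP u\<in>green_competitors \<Omega> w. u z)"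

definition robin_constant :: "complex set \<Rightarrow> complex \<Rightarrow> ereal" where
  "robin_constant \<Omega> w =
     Lim (at w) (\<lambda>z. green_function \<Omega> w z - ereal (ln (cmod (z - w))))"

(* exp (-\<infinity>) = 0 covers domains with polar complement.  The limit is never +\<infinity>: if the disc of
   radius R about w lies in \<Omega>, it is at most -ln R. *)
definition log_capacity :: "complex set \<Rightarrow> complex \<Rightarrow> real" where
  "log_capacity \<Omega> w =
     (if robin_constant \<Omega> w = -\<infinity> then 0 else exp (real_of_ereal (robin_constant \<Omega> w)))"

definition annulus :: "real \<Rightarrow> complex set" where
  "annulus r = {z. r < cmod z \<and> cmod z < 1}"

end

(*
  Put L = - ln r.  The function 1/z, whose square has integral 2 pi L over the annulus, gives
  K(sqrt r) >= 1 / (2 pi r L).  The exponential map presents the annulus as the quotient of the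
  strip -L < Re zeta < 0, whose Green function with pole -L/2 is ln |tan (pi (zeta + L/2) / (2 L))|.
  Summing it over all zeta with exp zeta = z gives the Green function of the annulus with pole
  sqrt r; the summands are negative, and the one with the pole alone yields the upper bound
  pi / (2 L sqrt r) for the capacity.  The two bounds combine to 2 L / pi^3.
*)
theory Submission
  imports Defs "HOL-Complex_Analysis.Complex_Analysis" "HOL-Real_Asymp.Real_Asymp"
begin

section \<open>The Bergman kernel\<close>

text \<open>\<open>robin_constant\<close> is a \<open>Lim\<close>, and this shapes the argument.
  Lifting a competitor to the strip would bound it by the summand with the pole, but an upper bound
  says nothing about a \<open>Lim\<close> whose existence is unknown. Hence the Green function is
  identified exactly: the sum over the fibre has to be a competitor and has to dominate all
  competitors, and only then are the other summands discarded. One estimate serves both halves: -ln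
  |tan z| \<le> cos (2 Re z) / (2 |sin z|^2). Its denominator grows at least quadratically along the
  sheets, which gives convergence; its numerator vanishes on both boundary lines of the strip, which
  gives boundary values 0 uniformly on the annulus. The point sqrt r lies under the centre of the
  strip, where tan vanishes with derivative 1; so the capacity bound is the slope pi / (2 L) of the
  coordinate on the strip times the derivative 1 / sqrt r of the logarithm.\<close>

lemma emeasure_lebesgue_cball_complex:
  fixes a :: complex
  assumes "0 \<le> s"
  shows "emeasure lebesgue (cball a s) = ennreal (pi * s\<^sup>2)"
proof -
  have "emeasure lebesgue (cball a s) = emeasure lborel (cball a s)"
    by simp
  also have "\<dots> = ennreal (pi * s\<^sup>2)"
    using assms by (simp add: emeasure_cball eval_unit_ball_vol)
  finally show ?thesis .
qed

text \<open>A maximum of the product of \<open>cmod (f z)\<close> with the distance to the circle replaces the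
  area mean value property: near it, Cauchy's inequality keeps \<open>cmod f\<close> from dropping by more
  than half.\<close>

lemma bdd_above_bergman:
  fixes \<Omega> :: "complex set"
  assumes "open \<Omega>" "w \<in> \<Omega>"
  shows "bdd_above {(cmod (f w))\<^sup>2 |f. f holomorphic_on \<Omega> \<and>
            (\<integral>\<^sup>+z\<in>\<Omega>. ennreal ((cmod (f z))\<^sup>2) \<partial>lebesgue) \<le> 1}"
proof -
  obtain R where R: "0 < R" "cball w R \<subseteq> \<Omega>"
    using assms open_contains_cball_eq by blast
  \<comment> \<open>1024 = 4 * 256: the 4 comes from halving \<open>cmod (f v)\<close>, the 256 from
    the disc of radius \<open>d/16\<close> over which the integral is bounded below.\<close>
  have "(cmod (f w))\<^sup>2 \<le> 1024 / (pi * R\<^sup>2)"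
    if f: "f holomorphic_on \<Omega>"
      and int: "(\<integral>\<^sup>+z\<in>\<Omega>. ennreal ((cmod (f z))\<^sup>2) \<partial>lebesgue) \<le> 1" for f
  proof (cases "f w = 0")
    case True
    then show ?thesis using R by simp
  next
    case False
    define m where "m z = cmod (f z) * (R - dist w z)" for z
    have contf: "continuous_on (cball w R) f"
      using f R holomorphic_on_imp_continuous_on holomorphic_on_subset by blast
    then have "continuous_on (cball w R) m"
      unfolding m_def by (intro continuous_intros)
    then obtain v where v: "v \<in> cball w R" "\<And>z. z \<in> cball w R \<Longrightarrow> m z \<le> m v"
      using continuous_attains_sup[of "cball w R" m] R by auto
    define d where "d = R - dist w v"
    have mw: "cmod (f w) * R \<le> cmod (f v) * d"
      using v(2)[of w] R by (simp add: m_def d_def)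
    have "0 < cmod (f w) * R" using False R by simp
    with mw have "0 < cmod (f v) * d" by simp
    moreover have "0 \<le> d" using v(1) by (simp add: d_def)
    ultimately have d: "0 < d"
      by (auto simp: zero_less_mult_iff)
    have sub: "cball v (d/2) \<subseteq> cball w R"
    proof
      fix z assume "z \<in> cball v (d/2)"
      then show "z \<in> cball w R"
        using dist_triangle[of w z v] d by (simp add: d_def)
    qed
    \<comment> \<open>Within \<open>d/2\<close> of \<open>v\<close> the distance to the circle is
      still at least \<open>d/2\<close>, so maximality of \<open>m v\<close> costs a factor
      2.\<close>
    have two: "cmod (f z) \<le> 2 * cmod (f v)" if z: "z \<in> cball v (d/2)" for z
    proof -
      have "d / 2 \<le> R - dist w z"
        using dist_triangle[of w z v] z d by (simp add: d_def)
      then have "cmod (f z) * (d / 2) \<le> cmod (f z) * (R - dist w z)"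
        by (intro mult_left_mono) auto
      also have "\<dots> \<le> cmod (f v) * d"
        using v(2)[of z] z sub by (auto simp: m_def d_def)
      finally show ?thesis using d by (simp add: field_simps)
    qed
    have der: "cmod (deriv f z) \<le> 8 * cmod (f v) / d" if z: "z \<in> ball v (d/4)" for z
    proof -
      have zs: "cball z (d/4) \<subseteq> cball v (d/2)"
      proof
        fix y assume "y \<in> cball z (d/4)"
        then show "y \<in> cball v (d/2)"
          using dist_triangle[of v y z] z by simp
      qed
      have h: "f holomorphic_on cball z (d/4)"
        using f R sub zs holomorphic_on_subset by blast
      have "cmod ((deriv ^^ 1) f z) \<le> fact 1 * (2 * cmod (f v)) / (d/4)^1"
      proof (rule Cauchy_inequality)
        show "f holomorphic_on ball z (d/4)"
          using h ball_subset_cball holomorphic_on_subset by blast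
        show "continuous_on (cball z (d/4)) f"
          using h holomorphic_on_imp_continuous_on by blast
        show "cmod (f x) \<le> 2 * cmod (f v)" if "cmod (z - x) = d/4" for x
          using that zs by (intro two) (auto simp: dist_norm)
      qed (use d in auto)
      then show ?thesis by simp
    qed
    \<comment> \<open>The radius is chosen so that the derivative bound
      \<open>8 * cmod (f v) / d\<close> lets \<open>f\<close> move by at most
      \<open>cmod (f v) / 2\<close>.\<close>
    have half: "cmod (f v) / 2 \<le> cmod (f z)" if z: "z \<in> cball v (d/16)" for z
    proof -
      have "cmod (f z - f v) \<le> 8 * cmod (f v) / d * cmod (z - v)"
      proof (rule field_differentiable_bound[of "ball v (d/4)" f "deriv f"])
        fix y assume y: "y \<in> ball v (d/4)"
        have "ball v (d/4) \<subseteq> \<Omega>"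
          using sub R(2) d order_trans[OF _ sub, of "ball v (d/4)"] subset_ball[of "d/4" "d/2" v]
            ball_subset_cball[of v "d/2"] by fastforce
        then have "f field_differentiable at y"
          using f y holomorphic_on_subset holomorphic_on_imp_differentiable_at[of f "ball v (d/4)"]
          by auto
        then show "(f has_field_derivative deriv f y) (at y within ball v (d/4))"
          by (simp add: DERIV_deriv_iff_field_differentiable has_field_derivative_at_within)
      qed (use der z d in auto)
      also have "\<dots> \<le> 8 * cmod (f v) / d * (d/16)"
        using z d by (intro mult_left_mono) (auto simp: dist_norm norm_minus_commute)
      also have "\<dots> = cmod (f v) / 2" using d by simp
      finally show ?thesis
        using norm_triangle_ineq2[of "f v" "f z"] by (simp add: norm_minus_commute)
    qed
    have "ennreal ((cmod (f v) / 2)\<^sup>2 * (pi * (d/16)\<^sup>2))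
        = (\<integral>\<^sup>+z. ennreal ((cmod (f v) / 2)\<^sup>2) * indicator (cball v (d/16)) z \<partial>lebesgue)"
      using d by (subst nn_integral_cmult_indicator)
        (auto simp: emeasure_lebesgue_cball_complex ennreal_mult simp del: emeasure_completion)
    also have "\<dots> \<le> (\<integral>\<^sup>+z\<in>\<Omega>. ennreal ((cmod (f z))\<^sup>2) \<partial>lebesgue)"
    proof (rule nn_integral_mono)
      fix z
      show "ennreal ((cmod (f v) / 2)\<^sup>2) * indicator (cball v (d/16)) z
        \<le> ennreal ((cmod (f z))\<^sup>2) * indicator \<Omega> z"
      proof (cases "z \<in> cball v (d/16)")
        case True
        then have "z \<in> cball v (d/2)" using d by auto
        then have "z \<in> \<Omega>" using sub R by blast
        have "(cmod (f v) / 2)\<^sup>2 \<le> (cmod (f z))\<^sup>2"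
          using half[OF True] by (intro power_mono) auto
        then show ?thesis using \<open>z \<in> \<Omega>\<close> by (auto simp: indicator_def ennreal_leI)
      qed simp
    qed
    also note int
    finally have "(cmod (f v) / 2)\<^sup>2 * (pi * (d/16)\<^sup>2) \<le> 1"
      by simp
    then have *: "(cmod (f v) * d)\<^sup>2 * pi \<le> 1024"
      by (simp add: power_mult_distrib power_divide field_simps)
    have "(cmod (f w) * R)\<^sup>2 * pi \<le> (cmod (f v) * d)\<^sup>2 * pi"
      using mw R by (intro mult_right_mono power_mono) auto
    with * have "(cmod (f w) * R)\<^sup>2 * pi \<le> 1024" by linarith
    then show ?thesis
      using R by (simp add: power_mult_distrib field_simps)
  qed
  then show ?thesis by (intro bdd_aboveI) blast
qed

text \<open>In place of polar coordinates, the annulus is cut into \<open>n\<close> rings whose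
  radii form a geometric progression. Bounding the integrand by its value on the inner circle, every
  ring contributes the same amount, and the total tends to the claimed value.\<close>

lemma nn_integral_annulus_inverse_square:
  assumes "0 < r" "r < 1"
  shows "(\<integral>\<^sup>+z\<in>annulus r. ennreal (1 / (cmod z)\<^sup>2) \<partial>lebesgue) \<le> ennreal (2 * pi * (- ln r))"
    (is "?I \<le> _")
proof -
  define L where "L = - ln r"
  have L: "0 < L" and rL: "r = exp (- L)" using assms by (auto simp: L_def)
  have bound: "?I \<le> ennreal (real n * pi * (exp (2 * L / real n) - 1))" if n: "1 \<le> n" for n :: nat
  proof -
    define q where "q = exp (- L / real n)"
    have q: "0 < q" "q < 1" using L n by (auto simp: q_def)
    have qn: "q ^ n = r"
      using n by (simp add: q_def rL flip: exp_of_nat_mult)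
    define E where "E k = cball 0 (q ^ k) - cball (0::complex) (q ^ Suc k)" for k
    have "?I \<le> (\<integral>\<^sup>+z. (\<Sum>k<n. ennreal (1 / (q ^ Suc k)\<^sup>2) * indicator (E k) z) \<partial>lebesgue)"
    proof (rule nn_integral_mono)
      fix z
      show "ennreal (1 / (cmod z)\<^sup>2) * indicator (annulus r) z
        \<le> (\<Sum>k<n. ennreal (1 / (q ^ Suc k)\<^sup>2) * indicator (E k) z)"
      proof (cases "z \<in> annulus r")
        case True
        \<comment> \<open>The ring containing \<open>z\<close> has index \<open>j - 1\<close>;
          \<open>j\<close> is not 0 because \<open>cmod z < 1 = q ^ 0\<close>.\<close>
        define j where "j = (LEAST k. q ^ k < cmod z)"
        have "q ^ n < cmod z" using True by (simp add: qn annulus_def)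
        then have j: "q ^ j < cmod z" "j \<le> n"
          unfolding j_def by (auto intro: LeastI Least_le)
        have "j \<noteq> 0" using j(1) True by (cases "j = 0") (auto simp: annulus_def)
        then obtain k where k: "j = Suc k" by (cases j) auto
        have "\<not> q ^ k < cmod z"
          using not_less_Least[of k "\<lambda>k. q ^ k < cmod z"] k by (simp add: j_def)
        then have zE: "z \<in> E k" using j k by (auto simp: E_def)
        have "1 / (cmod z)\<^sup>2 \<le> 1 / (q ^ Suc k)\<^sup>2"
          using j k q less_trans[of 0 "q ^ Suc k" "cmod z"]
          by (intro divide_left_mono power_mono mult_pos_pos zero_less_power) auto
        then have "ennreal (1 / (cmod z)\<^sup>2) \<le> ennreal (1 / (q ^ Suc k)\<^sup>2) * indicator (E k) z"
          using zE by (simp add: ennreal_leI)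
        also have "\<dots> \<le> (\<Sum>k<n. ennreal (1 / (q ^ Suc k)\<^sup>2) * indicator (E k) z)"
          using j k by (intro member_le_sum) auto
        finally show ?thesis using True by simp
      qed simp
    qed
    also have "\<dots> = (\<Sum>k<n. ennreal (1 / (q ^ Suc k)\<^sup>2) * emeasure lebesgue (E k))"
    proof (subst nn_integral_sum)
      have "E k \<in> sets lebesgue" for k
        unfolding E_def by (intro sets.Diff) (auto intro: fmeasurableD)
      then show "(\<Sum>k<n. \<integral>\<^sup>+z. ennreal (1 / (q ^ Suc k)\<^sup>2) * indicator (E k) z \<partial>lebesgue)
          = (\<Sum>k<n. ennreal (1 / (q ^ Suc k)\<^sup>2) * emeasure lebesgue (E k))"
        and "\<And>k. k \<in> {..<n} \<Longrightarrow> (\<lambda>z. ennreal (1 / (q ^ Suc k)\<^sup>2) * indicator (E k) z)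
          \<in> borel_measurable lebesgue"
        by (auto simp: nn_integral_cmult_indicator intro!: borel_measurable_times_ennreal)
    qed
    also have "\<dots> = (\<Sum>k<n. ennreal (pi * (exp (2 * L / real n) - 1)))"
    proof (rule sum.cong[OF refl])
      fix k
      have "emeasure lebesgue (E k) = emeasure lebesgue (cball (0::complex) (q ^ k))
          - emeasure lebesgue (cball (0::complex) (q ^ Suc k))"
        unfolding E_def using q subset_cball[OF power_decreasing[of k "Suc k" q], of 0]
        by (intro emeasure_Diff)
          (auto simp: emeasure_lebesgue_cball_complex simp del: emeasure_completion)
      also have "\<dots> = ennreal (pi * (q ^ k)\<^sup>2) - ennreal (pi * (q ^ Suc k)\<^sup>2)"
        using q by (simp add: emeasure_lebesgue_cball_complex del: emeasure_completion)
      also have "\<dots> = ennreal (pi * (q ^ k)\<^sup>2 - pi * (q ^ Suc k)\<^sup>2)"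
        using q by (intro ennreal_minus) auto
      finally have "ennreal (1 / (q ^ Suc k)\<^sup>2) * emeasure lebesgue (E k)
          = ennreal (1 / (q ^ Suc k)\<^sup>2 * (pi * (q ^ k)\<^sup>2 - pi * (q ^ Suc k)\<^sup>2))"
        by (simp only: ennreal_mult'[of "1 / (q ^ Suc k)\<^sup>2"] zero_le_power2 zero_le_divide_1_iff)
      also have "1 / (q ^ Suc k)\<^sup>2 * (pi * (q ^ k)\<^sup>2 - pi * (q ^ Suc k)\<^sup>2) = pi * (1 / q\<^sup>2 - 1)"
        using q by (simp add: field_simps power_mult_distrib)
      also have "1 / q\<^sup>2 = exp (2 * L / real n)"
        by (simp add: q_def exp_minus field_simps flip: exp_double)
      finally show "ennreal (1 / (q ^ Suc k)\<^sup>2) * emeasure lebesgue (E k)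
        = ennreal (pi * (exp (2 * L / real n) - 1))" .
    qed
    also have "\<dots> = ennreal (real n * pi * (exp (2 * L / real n) - 1))"
      using L by (simp add: ennreal_of_nat_eq_real_of_nat mult.assoc flip: ennreal_mult)
    finally show ?thesis .
  qed
  have "(\<lambda>n. real n * pi * (exp (2 * L / real n) - 1)) \<longlonglongrightarrow> 2 * pi * L"
    by real_asymp
  then have "(\<lambda>n. ennreal (real n * pi * (exp (2 * L / real n) - 1))) \<longlonglongrightarrow> ennreal (2 * pi * L)"
    by (intro tendsto_ennrealI)
  then show ?thesis
    unfolding L_def[symmetric] by (rule LIMSEQ_le_const) (use bound in blast)
qed

lemma annulus_eq_norm_vimage: "annulus r = cmod -` {r<..<1}"
  by (auto simp: annulus_def)

lemma open_annulus: "open (annulus r)"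
  unfolding annulus_eq_norm_vimage by (intro open_vimage continuous_intros open_greaterThanLessThan)

text \<open>A lower bound for a supremum asks for one admissible function, here a multiple
  \<open>c\<close> of 1/z, normalised by the upper bound for its integral. Boundedness of the set is
  what lets the real \<open>Sup\<close> dominate its elements.\<close>

lemma bergman_kernel_annulus_ge:
  assumes "0 < r" "r < 1" "w \<in> annulus r"
  shows "1 / (2 * pi * (- ln r) * (cmod w)\<^sup>2) \<le> bergman_kernel (annulus r) w"
proof -
  define c where "c = 1 / sqrt (2 * pi * (- ln r))"
  have L: "0 < - ln r" using assms by simp
  have c2: "c\<^sup>2 = 1 / (2 * pi * (- ln r))"
    using L by (simp add: c_def power_divide mult_nonneg_nonpos)
  define f where "f z = of_real c / z" for z :: complex
  have nz: "0 \<notin> annulus r" using assms by (simp add: annulus_def)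
  have "(\<integral>\<^sup>+z\<in>annulus r. ennreal ((cmod (f z))\<^sup>2) \<partial>lebesgue)
      = (\<integral>\<^sup>+z. ennreal (c\<^sup>2) * (ennreal (1 / (cmod z)\<^sup>2) * indicator (annulus r) z) \<partial>lebesgue)"
    by (simp add: f_def norm_divide power_divide flip: mult.assoc ennreal_mult')
  also have "\<dots> = ennreal (c\<^sup>2) * (\<integral>\<^sup>+z\<in>annulus r. ennreal (1 / (cmod z)\<^sup>2) \<partial>lebesgue)"
  proof (intro nn_integral_cmult borel_measurable_times_ennreal)
    have "(\<lambda>z::complex. ennreal (1 / (cmod z)\<^sup>2)) \<in> borel_measurable borel"
      by measurable
    then show "(\<lambda>z. ennreal (1 / (cmod z)\<^sup>2)) \<in> borel_measurable lebesgue"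
      by (intro measurable_completion) simp
    show "indicator (annulus r) \<in> borel_measurable lebesgue"
      using open_annulus[of r] by (intro borel_measurable_indicator) (auto intro: sets_completionI_sets)
  qed
  also have "\<dots> \<le> ennreal (c\<^sup>2) * ennreal (2 * pi * (- ln r))"
    using nn_integral_annulus_inverse_square[OF assms(1,2)] by (intro mult_left_mono) auto
  also have "\<dots> = 1"
    using L by (subst ennreal_mult[symmetric]) (auto simp: c2 mult_nonneg_nonpos)
  finally have "(cmod (f w))\<^sup>2 \<le> bergman_kernel (annulus r) w"
    unfolding bergman_kernel_def using nz
    by (intro cSup_upper bdd_above_bergman open_annulus assms CollectI exI[of _ f])
       (auto simp: f_def[abs_def] intro!: holomorphic_intros)
  then show ?thesis
    by (simp add: f_def norm_divide power_divide c2)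
qed


section \<open>Circle means and a comparison principle\<close>

text \<open>The positive part grows and the negative part shrinks, and nonnegative integrals are
  monotone for arbitrary functions, so competitors can be compared without asking for
  measurability.\<close>

lemma circle_mean_mono:
  assumes "0 \<le> s" "\<And>z. z \<in> sphere a s \<Longrightarrow> u z \<le> v z"
  shows "circle_mean u a s \<le> circle_mean v a s"
proof -
  have le: "u (a + of_real s * cis t) \<le> v (a + of_real s * cis t)" for t
    using assms by (intro assms(2)) (simp add: dist_norm norm_mult)
  show ?thesis
    unfolding circle_mean_def
    by (intro ereal_divide_right_mono ereal_minus_mono less_eq_ennreal.rep_eq[THEN iffD1]
        nn_integral_mono mult_right_mono e2ennreal_mono) (auto simp: le)
qed

text \<open>The bridge from the extended-real mean to \<open>has_integral\<close>, in which all mean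
  values are computed: continuity makes the integrals of both parts finite, so their difference is
  the ordinary integral.\<close>

lemma circle_mean_ereal:
  assumes cont: "continuous_on (sphere a s) f" and "0 \<le> s"
    and int: "((\<lambda>t. f (a + of_real s * cis t)) has_integral 2 * pi * m) {0..2*pi}"
  shows "circle_mean (\<lambda>z. ereal (f z)) a s = ereal m"
proof -
  define h where "h t = indicator {0..2*pi} t * f (a + of_real s * cis t)" for t
  have "continuous_on {0..2*pi} (\<lambda>t. f (a + of_real s * cis t))"
    using assms(2) by (intro continuous_on_compose2[OF cont] continuous_intros)
      (auto simp: dist_norm norm_mult)
  then have si: "set_integrable lborel {0..2*pi} (\<lambda>t. f (a + of_real s * cis t))"
    by (intro borel_integrable_compact[unfolded set_integrable_def[symmetric]]) auto
  then have hi: "integrable lborel h"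
    by (simp add: set_integrable_def h_def[abs_def])
  have "integral\<^sup>L lborel h = 2 * pi * m"
    using set_borel_integral_eq_integral(2)[OF si] int
    by (simp add: set_lebesgue_integral_def h_def[abs_def] integral_unique)
  then have diff: "enn2real (\<integral>\<^sup>+t. ennreal (h t) \<partial>lborel)
      - enn2real (\<integral>\<^sup>+t. ennreal (- h t) \<partial>lborel) = 2 * pi * m"
    using real_lebesgue_integral_def[OF hi] by simp
  have fin: "(\<integral>\<^sup>+t. ennreal (h t) \<partial>lborel) \<noteq> \<infinity>" "(\<integral>\<^sup>+t. ennreal (- h t) \<partial>lborel) \<noteq> \<infinity>"
    using hi by (simp_all add: real_integrable_def)
  have eq: "enn2ereal x = ereal (enn2real x)" if "x \<noteq> \<infinity>" for x
    using that by (cases x) auto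
  have "(\<integral>\<^sup>+t\<in>{0..2*pi}. e2ennreal (ereal (f (a + of_real s * cis t))) \<partial>lborel)
      = (\<integral>\<^sup>+t. ennreal (h t) \<partial>lborel)"
    by (intro nn_integral_cong) (auto simp: h_def indicator_def)
  moreover have "(\<integral>\<^sup>+t\<in>{0..2*pi}. e2ennreal (- ereal (f (a + of_real s * cis t))) \<partial>lborel)
      = (\<integral>\<^sup>+t. ennreal (- h t) \<partial>lborel)"
    by (intro nn_integral_cong) (auto simp: h_def indicator_def)
  ultimately show ?thesis
    using diff by (simp add: circle_mean_def eq[OF fin(1)] eq[OF fin(2)])
qed

section \<open>Mean value formulas\<close>

lemma holomorphic_mean_value:
  fixes f :: "complex \<Rightarrow> complex"
  assumes "f holomorphic_on S" "cball a s \<subseteq> S" "0 < s"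
  shows "((\<lambda>t. f (a + of_real s * cis t)) has_integral 2 * pi * f a) {0..2*pi}"
proof -
  have "((\<lambda>u. f u / (u - a)) has_contour_integral (2 * of_real pi * \<i> * f a)) (circlepath a s)"
    using assms by (intro Cauchy_integral_circlepath_simple) (auto intro: holomorphic_on_subset)
  then have "((\<lambda>t. f (a + of_real s * cis t) / (of_real s * cis t) * of_real s * \<i> * cis t)
      has_integral (2 * of_real pi * \<i> * f a)) {0..2*pi}"
    unfolding circlepath_def by (subst (asm) has_contour_integral_part_circlepath_iff) auto
  then have "((\<lambda>t. \<i> * f (a + of_real s * cis t)) has_integral (2 * of_real pi * \<i> * f a)) {0..2*pi}"
    by (rule has_integral_eq[rotated]) (use assms(3) in \<open>auto simp: field_simps\<close>)
  from has_integral_mult_right[OF this, of "-\<i>"] show ?thesis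
    by (simp add: algebra_simps)
qed

lemma holomorphic_mean_value_Re:
  assumes "f holomorphic_on S" "cball a s \<subseteq> S" "0 < s"
  shows "((\<lambda>t. Re (f (a + of_real s * cis t))) has_integral 2 * pi * Re (f a)) {0..2*pi}"
  using has_integral_linear[OF holomorphic_mean_value[OF assms] bounded_linear_Re]
  by (simp add: o_def)

text \<open>On the circle the squared norm agrees with the harmonic function Re (2
  \<open>cnj a\<close> z) plus the constant s^2 - |a|^2. The surplus s^2 of the mean over the value
  at the centre is what later yields strict superharmonicity.\<close>

lemma mean_value_norm_square:
  assumes "0 < s"
  shows "((\<lambda>t. (cmod (a + of_real s * cis t))\<^sup>2) has_integral 2 * pi * ((cmod a)\<^sup>2 + s\<^sup>2)) {0..2*pi}"
proof -
  have "((\<lambda>t. Re (2 * cnj a * (a + of_real s * cis t))) has_integral 2 * pi * Re (2 * cnj a * a))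
      {0..2*pi}"
    using assms by (intro holomorphic_mean_value_Re[of "\<lambda>z. 2 * cnj a * z" UNIV] holomorphic_intros) auto
  from has_integral_add[OF this has_integral_const_real[of "s\<^sup>2 - (cmod a)\<^sup>2" 0 "2*pi"]]
  have "((\<lambda>t. Re (2 * cnj a * (a + of_real s * cis t)) + (s\<^sup>2 - (cmod a)\<^sup>2)) has_integral
      (2 * pi * ((cmod a)\<^sup>2 + s\<^sup>2))) {0..2*pi}"
    by (simp add: cmod_power2) (simp add: power2_eq_square algebra_simps)
  moreover have "Re (2 * cnj a * (a + of_real s * cis t)) + (s\<^sup>2 - (cmod a)\<^sup>2)
      = (cmod (a + of_real s * cis t))\<^sup>2" for t
  proof -
    have "(cmod (a + of_real s * cis t))\<^sup>2
        = (cmod a)\<^sup>2 + s\<^sup>2 + 2 * s * (Re a * cos t + Im a * sin t)"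
      by (simp add: cmod_power2 power2_sum power_mult_distrib cos_squared_eq)
        (simp add: algebra_simps)
    then show ?thesis
      by (simp add: cmod_power2) (simp add: power2_eq_square algebra_simps)
  qed
  ultimately show ?thesis by simp
qed

text \<open>Without a maximum the open sets {f < f b} cover \<open>K\<close>. In a finite subcover
  the index \<open>b\<close> with the largest value would itself have to lie in one of the
  sets.\<close>

lemma usc_attains_max:
  fixes f :: "'a::topological_space \<Rightarrow> ereal"
  assumes "compact K" "K \<noteq> {}" and usc: "\<And>c. openin (top_of_set K) {z\<in>K. f z < c}"
  shows "\<exists>a\<in>K. \<forall>z\<in>K. f z \<le> f a"
proof (rule ccontr)
  assume "\<not> ?thesis"
  then have *: "\<And>a. a \<in> K \<Longrightarrow> \<exists>z\<in>K. f a < f z" by (auto simp: not_le)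
  define U where "U b = {z\<in>K. f z < f b}" for b
  have "K \<subseteq> \<Union> (U ` K)" using * by (auto simp: U_def)
  then obtain D where D: "D \<subseteq> U ` K" "finite D" "K \<subseteq> \<Union> D"
    using \<open>compact K\<close>[unfolded compact_eq_openin_cover, rule_format, of "U ` K"] usc
    by (auto simp: U_def)
  then obtain B where B: "B \<subseteq> K" "finite B" "D = U ` B"
    by (meson finite_subset_image)
  have "B \<noteq> {}" using B D assms(2) by auto
  then obtain b where b: "b \<in> B" "\<And>c. c \<in> B \<Longrightarrow> f c \<le> f b"
    using Max_in[of "f ` B"] B(2) by (smt (verit) Max_ge finite_imageI image_iff image_is_empty)
  then obtain c where "c \<in> B" "f b < f c" using B D by (auto simp: U_def)
  with b show False by (auto simp: not_le[symmetric])
qed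

lemma subharmonic_le_strict_superharmonic:
  fixes \<phi> :: "complex \<Rightarrow> real"
  assumes sub: "subharmonic_on u \<Omega>" and V: "open V" "V \<subseteq> \<Omega>"
    and cont: "continuous_on V \<phi>"
    and mean: "\<And>a. a \<in> V \<Longrightarrow> \<exists>\<rho>>0. \<forall>s. 0 < s \<and> s < \<rho> \<longrightarrow>
      (\<exists>m < \<phi> a. ((\<lambda>t. \<phi> (a + of_real s * cis t)) has_integral 2 * pi * m) {0..2*pi})"
    and K: "compact K" "K \<subseteq> V" and le: "\<And>z. z \<in> V - K \<Longrightarrow> u z \<le> ereal (\<phi> z)"
    and z: "z \<in> V"
  shows "u z \<le> ereal (\<phi> z)"
proof (rule ccontr)
  assume nz: "\<not> ?thesis"
  define v where "v x = u x - ereal (\<phi> x)" for x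
  have fin: "u x < \<infinity>" if "x \<in> V" for x
    using sub V that by (auto simp: subharmonic_on_def)
  have lt: "v x < ereal c \<longleftrightarrow> u x < ereal (\<phi> x + c)" for x c
    by (cases "u x") (auto simp: v_def)
  have zK: "z \<in> K" using nz le z by blast
  have "\<exists>a\<in>K. \<forall>x\<in>K. v x \<le> v a"
  proof (rule usc_attains_max)
    fix c
    show "openin (top_of_set K) {x\<in>K. v x < c}"
    proof (cases c)
      case PInf
      then have "{x\<in>K. v x < c} = K"
      proof -
        have "v x < \<infinity>" if "x \<in> K" for x
          using fin[of x] that K by (cases "u x") (auto simp: v_def)
        then show ?thesis using PInf by auto
      qed
      then show ?thesis by simp
    next
      case (real c')
      show ?thesis
      proof (subst openin_subopen, safe)
        fix x assume x: "x \<in> K" "v x < c"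
        then have "u x < ereal (\<phi> x + c')" using lt real by simp
        \<comment> \<open>The level \<open>d\<close> separates the two functions near
          \<open>x\<close>: where u < d and \<phi> > d - c' both hold, u < \<phi> + c' follows, and
          each condition is open.\<close>
        then obtain d where d: "u x < ereal d" "d < \<phi> x + c'"
          using ereal_dense2[of "u x" "ereal (\<phi> x + c')"] by auto
        have "openin (top_of_set \<Omega>) {y\<in>\<Omega>. u y < ereal d}"
          using sub by (auto simp: subharmonic_on_def)
        then obtain T where "open T" "{y\<in>\<Omega>. u y < ereal d} = \<Omega> \<inter> T"
          by (auto simp: openin_open)
        moreover have "K \<inter> (\<Omega> \<inter> T) = K \<inter> T" using K V by blast
        ultimately have 1: "openin (top_of_set K) (K \<inter> {y\<in>\<Omega>. u y < ereal d})"
          by (auto simp: openin_open)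
        have 2: "openin (top_of_set K) (K \<inter> \<phi> -` {d - c'<..})"
          using cont K by (intro continuous_openin_preimage_gen) (auto intro: continuous_on_subset)
        show "\<exists>T. openin (top_of_set K) T \<and> x \<in> T \<and> T \<subseteq> {x\<in>K. v x < c}"
        proof (intro exI conjI)
          show "openin (top_of_set K) ((K \<inter> {y\<in>\<Omega>. u y < ereal d}) \<inter> (K \<inter> \<phi> -` {d - c'<..}))"
            using 1 2 by (rule openin_Int)
          show "x \<in> (K \<inter> {y\<in>\<Omega>. u y < ereal d}) \<inter> (K \<inter> \<phi> -` {d - c'<..})"
            using x d K V by auto
          show "(K \<inter> {y\<in>\<Omega>. u y < ereal d}) \<inter> (K \<inter> \<phi> -` {d - c'<..}) \<subseteq> {x\<in>K. v x < c}"
            using real lt by (auto elim!: less_trans)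
        qed
      qed
    qed simp
  qed (use K zK in auto)
  then obtain a where a: "a \<in> K" "\<And>x. x \<in> K \<Longrightarrow> v x \<le> v a" by blast
  have "0 < v z" using nz lt[of z 0] fin[OF z]
    by (cases "u z") (auto simp: v_def not_le)
  then have "0 < v a" using a(2)[OF zK] by auto
  then obtain M where M: "v a = ereal M" "0 < M" "u a = ereal (\<phi> a + M)"
    using fin[of a] a(1) K(2) by (cases "u a") (auto simp: v_def)
  \<comment> \<open>Off \<open>K\<close> the difference is at most 0, hence below \<open>M\<close>;
    so circles around \<open>a\<close> may leave \<open>K\<close>.\<close>
  have leM: "u x \<le> ereal (\<phi> x + M)" if "x \<in> V" for x
  proof (cases "x \<in> K")
    case True
    then show ?thesis using a(2)[OF True] M(1) by (cases "u x") (auto simp: v_def)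
  next
    case False
    then have "u x \<le> ereal (\<phi> x)" using le that by blast
    also have "\<dots> \<le> ereal (\<phi> x + M)" using M by simp
    finally show ?thesis .
  qed
  have aV: "a \<in> V" using a K by blast
  obtain \<rho>1 where \<rho>1: "0 < \<rho>1" "\<And>s. 0 < s \<Longrightarrow> s < \<rho>1 \<Longrightarrow> u a \<le> circle_mean u a s"
  proof -
    have "a \<in> \<Omega>" using aV V by blast
    then have "\<exists>\<rho>>0. ball a \<rho> \<subseteq> \<Omega> \<and> (\<forall>s. 0 < s \<and> s < \<rho> \<longrightarrow> u a \<le> circle_mean u a s)"
      using sub unfolding subharmonic_on_def by blast
    then show ?thesis using that by blast
  qed
  obtain \<rho>2 where \<rho>2: "0 < \<rho>2" "\<And>s. 0 < s \<Longrightarrow> s < \<rho>2 \<Longrightarrow>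
      (\<exists>m < \<phi> a. ((\<lambda>t. \<phi> (a + of_real s * cis t)) has_integral 2 * pi * m) {0..2*pi})"
    using mean[OF aV] by blast
  obtain \<rho>3 where \<rho>3: "0 < \<rho>3" "ball a \<rho>3 \<subseteq> V"
    using V aV open_contains_ball by blast
  define s where "s = min \<rho>1 (min \<rho>2 \<rho>3) / 2"
  have s: "0 < s" "s < \<rho>1" "s < \<rho>2" "s < \<rho>3" using \<rho>1 \<rho>2 \<rho>3 by (auto simp: s_def)
  have sV: "sphere a s \<subseteq> V" using s \<rho>3 by (auto simp: subset_iff)
  obtain m where m: "m < \<phi> a"
    "((\<lambda>t. \<phi> (a + of_real s * cis t)) has_integral 2 * pi * m) {0..2*pi}"
    using \<rho>2(2)[OF s(1) s(3)] by blast
  have "((\<lambda>t. \<phi> (a + of_real s * cis t) + M) has_integral 2 * pi * (m + M)) {0..2*pi}"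
    using has_integral_add[OF m(2) has_integral_const_real[of M 0 "2*pi"]] by (simp add: algebra_simps)
  then have "circle_mean (\<lambda>z. ereal (\<phi> z + M)) a s = ereal (m + M)"
    using s by (intro circle_mean_ereal continuous_intros continuous_on_subset[OF cont sV]) auto
  moreover have "circle_mean u a s \<le> circle_mean (\<lambda>z. ereal (\<phi> z + M)) a s"
    using s sV by (intro circle_mean_mono leM) auto
  moreover have "u a \<le> circle_mean u a s" using \<rho>1(2) s by blast
  ultimately have "u a \<le> ereal (m + M)" by simp
  then show False using m M by simp
qed


section \<open>The Green function of the strip\<close>

lemma exp_minus_inverse_square:
  "(exp x - inverse (exp x))\<^sup>2 = exp (2 * x) + inverse (exp (2 * x)) - 2" for x :: real
  by (simp add: power2_diff exp_double power_inverse)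

text \<open>The reason why tan maps the strip |Re z| < pi/4 into the unit disc: there the right-hand
  side is positive.\<close>

lemma norm_cos_minus_norm_sin_square: "(cmod (cos z))\<^sup>2 - (cmod (sin z))\<^sup>2 = cos (2 * Re z)"
  unfolding norm_cos_squared norm_sin_squared exp_minus_inverse_square
  by (simp add: add_divide_distrib diff_divide_distrib cos_double_cos)

text \<open>Both come from |sin z|^2 = sin^2 (Re z) + sinh^2 (Im z). The first gives the decay along
  the sheets; the second keeps the sine away from 0 near the boundary of the strip, whatever the
  imaginary part.\<close>

lemma norm_sin_square_ge:
  "(Im z)\<^sup>2 \<le> (cmod (sin z))\<^sup>2" "(1 - cos (2 * Re z)) / 2 \<le> (cmod (sin z))\<^sup>2"
proof -
  have *: "(cmod (sin z))\<^sup>2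
      = (1 - cos (2 * Re z)) / 2 + ((exp (Im z) - inverse (exp (Im z))) / 2)\<^sup>2"
    unfolding norm_sin_squared power_divide exp_minus_inverse_square
    by (simp add: add_divide_distrib diff_divide_distrib)
  have "\<bar>Im z\<bar>\<^sup>2 \<le> \<bar>(exp (Im z) - inverse (exp (Im z))) / 2\<bar>\<^sup>2"
    using real_le_abs_sinh[of "Im z"] by (intro power_mono) auto
  then have "(Im z)\<^sup>2 \<le> ((exp (Im z) - inverse (exp (Im z))) / 2)\<^sup>2"
    by (simp only: power2_abs)
  then show "(Im z)\<^sup>2 \<le> (cmod (sin z))\<^sup>2"
    unfolding * using add_mono[of 0 "(1 - cos (2 * Re z)) / 2"] by fastforce
  show "(1 - cos (2 * Re z)) / 2 \<le> (cmod (sin z))\<^sup>2"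
    unfolding * by simp
qed

text \<open>The last estimate is ln x \<le> x - 1 at x = |cos z / sin z|^2, where the numerator of x
  - 1 becomes \<open>cos (2 * Re z)\<close> by the identity for the squared norms.\<close>

lemma
  assumes z: "\<bar>Re z\<bar> < pi / 4"
  shows cos_nonzero_of_Re_bound: "cos z \<noteq> 0"
    and cos_double_Re_pos: "0 < cos (2 * Re z)"
    and tan_nonzero_of_Re_bound: "z \<noteq> 0 \<Longrightarrow> tan z \<noteq> 0"
    and neg_ln_cmod_tan_nonneg: "0 \<le> - ln (cmod (tan z))"
    and neg_ln_cmod_tan_pos: "z \<noteq> 0 \<Longrightarrow> 0 < - ln (cmod (tan z))"
    and neg_ln_cmod_tan_le: "- ln (cmod (tan z)) \<le> cos (2 * Re z) / (2 * (cmod (sin z))\<^sup>2)"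
proof -
  show pos: "0 < cos (2 * Re z)"
    using z by (intro cos_gt_zero_pi) auto
  have gt: "(cmod (sin z))\<^sup>2 < (cmod (cos z))\<^sup>2"
    using pos norm_cos_minus_norm_sin_square[of z] by simp
  then show c: "cos z \<noteq> 0"
    using zero_le_power2[of "cmod (sin z)"] by (auto simp: not_less)
  have s: "sin z \<noteq> 0" if "z \<noteq> 0"
  proof
    assume "sin z = 0"
    with norm_sin_square_ge[of z] have "Im z = 0" "1 \<le> cos (2 * Re z)" by auto
    moreover have "\<bar>2 * Re z\<bar> \<le> pi" using z by linarith
    ultimately have "Re z = 0"
      using cos_monotone_0_pi[of 0 "\<bar>2 * Re z\<bar>"] by (cases "Re z = 0") auto
    then show False using \<open>Im z = 0\<close> that by (simp add: complex_eq_iff)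
  qed
  then show t: "tan z \<noteq> 0" if "z \<noteq> 0"
    using c that by (simp add: tan_def)
  have le1: "0 < - ln (cmod (tan z))
      \<and> - ln (cmod (tan z)) \<le> cos (2 * Re z) / (2 * (cmod (sin z))\<^sup>2)" if "z \<noteq> 0"
  proof -
    define A B where "A = cmod (sin z)" and "B = cmod (cos z)"
    have AB: "0 < A" "A < B"
      using s[OF that] gt by (auto simp: A_def B_def power_less_imp_less_base)
    have eq: "- ln (cmod (tan z)) = ln (B / A)"
      using AB by (simp add: tan_def norm_divide A_def B_def ln_div)
    have "2 * ln (B / A) = ln ((B / A)\<^sup>2)"
      using AB by (simp add: ln_realpow)
    also have "\<dots> \<le> (B / A)\<^sup>2 - 1"
      using AB by (intro ln_le_minus_one) auto
    also have "\<dots> = cos (2 * Re z) / A\<^sup>2"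
      using AB norm_cos_minus_norm_sin_square[of z] by (simp add: field_simps A_def B_def)
    finally have "ln (B / A) \<le> cos (2 * Re z) / (2 * A\<^sup>2)"
      by simp
    moreover have "0 < ln (B / A)"
      using AB by (intro ln_gt_zero) simp
    ultimately show ?thesis
      unfolding eq by (simp add: A_def)
  qed
  then show "0 < - ln (cmod (tan z))" if "z \<noteq> 0"
    using that by blast
  \<comment> \<open>At z = 0 both sides of the second bound are 0, by \<open>ln 0 = 0\<close> and
    division by 0.\<close>
  show "0 \<le> - ln (cmod (tan z))" "- ln (cmod (tan z)) \<le> cos (2 * Re z) / (2 * (cmod (sin z))\<^sup>2)"
    using le1 by (cases "z = 0"; force)+
qed

text \<open>The affine map from the strip -L < Re \<zeta> < 0 onto |Re z| < pi/4 that sends the pole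
  -L/2 to 0.\<close>

definition strip_coord :: "real \<Rightarrow> complex \<Rightarrow> complex" where
  "strip_coord L \<zeta> = of_real (pi / (2 * L)) * (\<zeta> + of_real (L / 2))"

definition strip_green :: "real \<Rightarrow> complex \<Rightarrow> real" where
  "strip_green L \<zeta> = - ln (cmod (tan (strip_coord L \<zeta>)))"

text \<open>The deck transformations of the exponential map, enumerated by natural numbers so that
  number 0 is the identity and sums over a fibre become ordinary series.\<close>

definition sheet :: "nat \<Rightarrow> complex \<Rightarrow> complex" where
  "sheet n \<zeta> = \<zeta> + of_real (2 * pi * of_int (int_decode n)) * \<i>"

text \<open>\<open>strip_green\<close> and \<open>annulus_green\<close> are minus the Green functions.  The bound on \<open>Im\<close> in
  \<open>band\<close> leaves room for a branch of the logarithm around every point of the annulus, including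
  those on the cut of \<open>Ln\<close>, while only the sheet \<open>0\<close> meets the pole.\<close>

definition annulus_green :: "real \<Rightarrow> complex \<Rightarrow> real" where
  "annulus_green L z = infsum (strip_green L) {\<zeta>. exp \<zeta> = z}"

definition green_tail :: "real \<Rightarrow> complex \<Rightarrow> real" where
  "green_tail L \<zeta> = (\<Sum>n. strip_green L (sheet (Suc n) \<zeta>))"

definition band :: "real \<Rightarrow> complex set" where
  "band L = {\<zeta>. - L < Re \<zeta> \<and> Re \<zeta> < 0 \<and> \<bar>Im \<zeta>\<bar> < 3 * pi / 2}"

text \<open>This is 2 L^2 / (pi^2 y^2) with y = pi (n + 1) / 4, the lower bound for the imaginary
  part on sheet n + 1.\<close>

definition tail_coeff :: "real \<Rightarrow> nat \<Rightarrow> real" where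
  "tail_coeff L n = 32 * L\<^sup>2 / pi ^ 4 * inverse (real (Suc n) ^ 2)"

lemma Re_sheet [simp]: "Re (sheet n \<zeta>) = Re \<zeta>"
  and Im_sheet: "Im (sheet n \<zeta>) = Im \<zeta> + 2 * pi * of_int (int_decode n)"
  by (simp_all add: sheet_def)

lemma sheet_0 [simp]: "sheet 0 \<zeta> = \<zeta>"
  by (simp add: sheet_def int_decode_def sum_decode_def)

lemma abs_int_decode_ge: "real n / 2 \<le> \<bar>of_int (int_decode n)\<bar>"
  by (cases "even n") (auto simp: int_decode_def sum_decode_def field_simps elim!: evenE oddE)

lemma bij_betw_sheet: "bij_betw (\<lambda>n. sheet n \<zeta>) UNIV {\<xi>. exp \<xi> = exp \<zeta>}"
  unfolding bij_betw_def
proof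
  show "inj (\<lambda>n. sheet n \<zeta>)"
    by (rule injI) (auto simp: sheet_def complex_eq_iff dest: inj_onD[OF inj_int_decode])
  show "range (\<lambda>n. sheet n \<zeta>) = {\<xi>. exp \<xi> = exp \<zeta>}"
  proof (intro equalityI subsetI)
    fix \<xi> assume "\<xi> \<in> {\<xi>. exp \<xi> = exp \<zeta>}"
    then obtain k :: int where "\<xi> = \<zeta> + (of_int (2 * k) * pi) * \<i>"
      by (auto simp: exp_eq)
    then have "\<xi> = sheet (int_encode k) \<zeta>"
      by (simp add: sheet_def)
    then show "\<xi> \<in> range (\<lambda>n. sheet n \<zeta>)" by blast
  next
    fix \<xi> assume "\<xi> \<in> range (\<lambda>n. sheet n \<zeta>)"
    then obtain n where "\<xi> = \<zeta> + (of_int (2 * int_decode n) * pi) * \<i>"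
      by (auto simp: sheet_def)
    then show "\<xi> \<in> {\<xi>. exp \<xi> = exp \<zeta>}"
      by (auto simp: exp_eq)
  qed
qed

lemma contractible_ball: "contractible (ball (a::complex) \<rho>)"
  by (simp add: convex_imp_contractible)

text \<open>A nonvanishing holomorphic function on a disc has a holomorphic logarithm, and the
  logarithm of its modulus is the real part of that.\<close>

lemma ln_cmod_mean_value:
  assumes f: "f holomorphic_on ball a \<rho>" "\<And>z. z \<in> ball a \<rho> \<Longrightarrow> f z \<noteq> 0"
    and s: "0 < s" "s < \<rho>"
  shows "((\<lambda>t. ln (cmod (f (a + of_real s * cis t)))) has_integral 2 * pi * ln (cmod (f a))) {0..2*pi}"
proof -
  obtain g where g: "g holomorphic_on ball a \<rho>" "\<And>z. z \<in> ball a \<rho> \<Longrightarrow> f z = exp (g z)"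
    using contractible_imp_holomorphic_log[OF f(1) contractible_ball f(2)] by blast
  have eq: "ln (cmod (f z)) = Re (g z)" if "z \<in> ball a \<rho>" for z
    using g(2)[OF that] by simp
  have "((\<lambda>t. Re (g (a + of_real s * cis t))) has_integral 2 * pi * Re (g a)) {0..2*pi}"
    using s by (intro holomorphic_mean_value_Re[OF g(1)]) auto
  then show ?thesis
    using s by (subst eq) (auto simp: dist_norm norm_mult eq)
qed

section \<open>Green function of the strip and convergence of the sum over sheets\<close>

context
  fixes L :: real
  assumes L: "0 < L"
begin

lemma Re_strip_coord: "Re (strip_coord L \<zeta>) = pi / (2 * L) * (Re \<zeta> + L / 2)"
  and Im_strip_coord: "Im (strip_coord L \<zeta>) = pi / (2 * L) * Im \<zeta>"
  by (simp_all add: strip_coord_def)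

lemma strip_coord_eq_0_iff: "strip_coord L \<zeta> = 0 \<longleftrightarrow> \<zeta> = - of_real (L / 2)"
  using L by (auto simp: strip_coord_def add_eq_0_iff2)

lemma abs_Re_strip_coord_less:
  assumes "- L < Re \<zeta>" "Re \<zeta> < 0"
  shows "\<bar>Re (strip_coord L \<zeta>)\<bar> < pi / 4"
proof -
  have "\<bar>Re \<zeta> + L / 2\<bar> < L / 2" using assms by linarith
  then have "pi / (2 * L) * \<bar>Re \<zeta> + L / 2\<bar> < pi / (2 * L) * (L / 2)"
    using L by (intro mult_strict_left_mono divide_pos_pos) auto
  then show ?thesis using L by (simp add: Re_strip_coord abs_mult)
qed

text \<open>Source of the recurring factor \<open>cos (pi * (Re \<zeta> / L + 1 / 2))\<close>, which
  is positive in the strip and vanishes on both boundary lines.\<close>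

lemma double_Re_strip_coord: "2 * Re (strip_coord L \<zeta>) = pi * (Re \<zeta> / L + 1 / 2)"
  using L by (simp add: Re_strip_coord field_simps)

lemma strip_green_nonneg:
  assumes "- L < Re \<zeta>" "Re \<zeta> < 0"
  shows "0 \<le> strip_green L \<zeta>"
  unfolding strip_green_def using abs_Re_strip_coord_less[OF assms] by (rule neg_ln_cmod_tan_nonneg)

lemma strip_green_pos:
  assumes "- L < Re \<zeta>" "Re \<zeta> < 0" "\<zeta> \<noteq> - of_real (L / 2)"
  shows "0 < strip_green L \<zeta>"
  unfolding strip_green_def using abs_Re_strip_coord_less[OF assms(1,2)] assms(3)
  by (intro neg_ln_cmod_tan_pos) (auto simp: strip_coord_eq_0_iff)

lemma strip_green_le_Im:
  assumes "- L < Re \<zeta>" "Re \<zeta> < 0" "Im \<zeta> \<noteq> 0"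
  shows "strip_green L \<zeta> \<le> cos (pi * (Re \<zeta> / L + 1 / 2)) * (2 * L\<^sup>2 / (pi\<^sup>2 * (Im \<zeta>)\<^sup>2))"
proof -
  note b = abs_Re_strip_coord_less[OF assms(1,2)]
  define c where "c = cos (pi * (Re \<zeta> / L + 1 / 2))"
  have c: "0 < c" using cos_double_Re_pos[OF b] by (simp add: double_Re_strip_coord c_def)
  have y: "0 < (Im (strip_coord L \<zeta>))\<^sup>2" using assms L by (simp add: Im_strip_coord)
  have "strip_green L \<zeta> \<le> c / (2 * (cmod (sin (strip_coord L \<zeta>)))\<^sup>2)"
    using neg_ln_cmod_tan_le[OF b] by (simp add: strip_green_def double_Re_strip_coord c_def)
  also have "\<dots> \<le> c / (2 * (Im (strip_coord L \<zeta>))\<^sup>2)"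
    using c y norm_sin_square_ge(1)[of "strip_coord L \<zeta>"]
    by (intro divide_left_mono mult_left_mono mult_pos_pos) auto
  also have "\<dots> = c * (2 * L\<^sup>2 / (pi\<^sup>2 * (Im \<zeta>)\<^sup>2))"
    using L by (simp add: Im_strip_coord power_mult_distrib power_divide field_simps)
  finally show ?thesis by (simp add: c_def)
qed

text \<open>Meant for the sheet with the pole, where Im \<zeta> may be 0. A small cosine puts
  \<zeta> near the boundary, hence away from the pole, and forces |sin|^2 \<ge> 1/4.\<close>

lemma strip_green_le_boundary:
  assumes "- L < Re \<zeta>" "Re \<zeta> < 0" and c: "cos (pi * (Re \<zeta> / L + 1 / 2)) \<le> 1 / 2"
  shows "strip_green L \<zeta> \<le> 2 * cos (pi * (Re \<zeta> / L + 1 / 2))"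
proof -
  note b = abs_Re_strip_coord_less[OF assms(1,2)]
  define S where "S = (cmod (sin (strip_coord L \<zeta>)))\<^sup>2"
  have "1 / 4 \<le> S"
    using norm_sin_square_ge(2)[of "strip_coord L \<zeta>"] c by (simp add: double_Re_strip_coord S_def)
  then have "cos (pi * (Re \<zeta> / L + 1 / 2)) / (2 * S) \<le> cos (pi * (Re \<zeta> / L + 1 / 2)) / (2 * (1 / 4))"
    using cos_double_Re_pos[OF b] by (intro divide_left_mono mult_left_mono)
      (auto simp: double_Re_strip_coord)
  with neg_ln_cmod_tan_le[OF b] show ?thesis
    by (simp add: strip_green_def double_Re_strip_coord S_def)
qed

text \<open>A shift by 2 pi k with k \<ge> 1 minus an imaginary part below 3 pi / 2 leaves at least
  pi k / 2, and k \<ge> n / 2.\<close>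

lemma Im_sheet_ge:
  assumes "\<zeta> \<in> band L" "n \<noteq> 0"
  shows "pi * real n / 4 \<le> \<bar>Im (sheet n \<zeta>)\<bar>"
proof -
  define k where "k = \<bar>real_of_int (int_decode n)\<bar>"
  have n: "real n / 2 \<le> k" "1 \<le> real n" using abs_int_decode_ge[of n] assms(2) by (auto simp: k_def)
  then have "int_decode n \<noteq> 0" by (auto simp: k_def)
  then have "1 \<le> \<bar>int_decode n\<bar>" by linarith
  then have k1: "1 \<le> k" by (simp add: k_def)
  have "2 * pi * k \<le> \<bar>Im (sheet n \<zeta>)\<bar> + \<bar>Im \<zeta>\<bar>"
    by (simp add: Im_sheet k_def abs_mult flip: abs_mult_pos)
  moreover have "\<bar>Im \<zeta>\<bar> \<le> 3 / 2 * (pi * k)"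
  proof -
    have "\<bar>Im \<zeta>\<bar> < 3 * pi / 2" using assms(1) by (simp add: band_def)
    moreover have "pi \<le> pi * k" using mult_left_mono[OF k1, of pi] by simp
    ultimately show ?thesis by linarith
  qed
  moreover have "pi * (real n / 2) \<le> pi * k"
    using n by (intro mult_left_mono) auto
  ultimately show ?thesis by linarith
qed

lemma summable_tail_coeff: "summable (tail_coeff L)"
proof -
  have "summable (\<lambda>n. inverse (real (Suc n) ^ 2))"
    using inverse_power_summable[of 2, where 'a = real] by (subst summable_Suc_iff) auto
  then show ?thesis
    unfolding tail_coeff_def[abs_def] by (rule summable_mult)
qed

lemma strip_green_sheet_le:
  assumes "\<zeta> \<in> band L"
  shows "strip_green L (sheet (Suc n) \<zeta>) \<le> cos (pi * (Re \<zeta> / L + 1 / 2)) * tail_coeff L n"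
proof -
  note i = Im_sheet_ge[OF assms, of "Suc n"]
  have re: "- L < Re \<zeta>" "Re \<zeta> < 0" using assms by (auto simp: band_def)
  have pos: "0 < pi * real (Suc n) / 4" by simp
  have "strip_green L (sheet (Suc n) \<zeta>)
      \<le> cos (pi * (Re \<zeta> / L + 1 / 2)) * (2 * L\<^sup>2 / (pi\<^sup>2 * (Im (sheet (Suc n) \<zeta>))\<^sup>2))"
    using strip_green_le_Im[of "sheet (Suc n) \<zeta>"] re i[OF nat.simps(3)] pos
    by (metis Re_sheet abs_zero not_le)
  also have "\<dots> \<le> cos (pi * (Re \<zeta> / L + 1 / 2)) * (2 * L\<^sup>2 / (pi\<^sup>2 * (pi * real (Suc n) / 4)\<^sup>2))"
  proof (intro mult_left_mono divide_left_mono)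
    show "(pi * real (Suc n) / 4)\<^sup>2 \<le> (Im (sheet (Suc n) \<zeta>))\<^sup>2"
      using power_mono[OF i[OF nat.simps(3)], of 2] pos by simp
    show "0 \<le> cos (pi * (Re \<zeta> / L + 1 / 2))"
      using cos_double_Re_pos[OF abs_Re_strip_coord_less[OF re]] by (simp add: double_Re_strip_coord)
    show "0 < pi\<^sup>2 * (Im (sheet (Suc n) \<zeta>))\<^sup>2 * (pi\<^sup>2 * (pi * real (Suc n) / 4)\<^sup>2)"
      using less_le_trans[OF pos i[OF nat.simps(3)]] pos by (intro mult_pos_pos) simp_all
  qed auto
  also have "2 * L\<^sup>2 / (pi\<^sup>2 * (pi * real (Suc n) / 4)\<^sup>2) = tail_coeff L n"
    by (simp add: tail_coeff_def field_simps power2_eq_square power4_eq_xxxx)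
  finally show ?thesis .
qed

lemma strip_green_sheet_norm_le:
  assumes "\<zeta> \<in> band L"
  shows "norm (strip_green L (sheet (Suc n) \<zeta>)) \<le> tail_coeff L n"
proof -
  have "0 \<le> tail_coeff L n" by (simp add: tail_coeff_def)
  then have "cos (pi * (Re \<zeta> / L + 1 / 2)) * tail_coeff L n \<le> 1 * tail_coeff L n"
    by (intro mult_right_mono) auto
  moreover have "0 \<le> strip_green L (sheet (Suc n) \<zeta>)"
    using assms by (intro strip_green_nonneg) (auto simp: band_def)
  ultimately show ?thesis using strip_green_sheet_le[OF assms, of n] by simp
qed

lemma summable_strip_green_sheet:
  assumes "\<zeta> \<in> band L"
  shows "summable (\<lambda>n. strip_green L (sheet (Suc n) \<zeta>))"
  using strip_green_sheet_norm_le[OF assms]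
  by (intro summable_comparison_test'[OF summable_tail_coeff]) auto

lemma green_tail_nonneg:
  assumes "\<zeta> \<in> band L"
  shows "0 \<le> green_tail L \<zeta>"
  unfolding green_tail_def using assms
  by (intro suminf_nonneg summable_strip_green_sheet strip_green_nonneg) (auto simp: band_def)

lemma green_tail_le:
  assumes "\<zeta> \<in> band L"
  shows "green_tail L \<zeta> \<le> cos (pi * (Re \<zeta> / L + 1 / 2)) * suminf (tail_coeff L)"
proof -
  have "green_tail L \<zeta> \<le> (\<Sum>n. cos (pi * (Re \<zeta> / L + 1 / 2)) * tail_coeff L n)"
    unfolding green_tail_def using assms
    by (intro suminf_le strip_green_sheet_le summable_strip_green_sheet summable_mult
        summable_tail_coeff)
  then show ?thesis by (simp add: suminf_mult summable_tail_coeff)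
qed

lemma continuous_on_strip_green:
  assumes "\<And>\<zeta>. \<zeta> \<in> S \<Longrightarrow> - L < Re \<zeta> \<and> Re \<zeta> < 0 \<and> \<zeta> \<noteq> - of_real (L / 2)"
  shows "continuous_on S (strip_green L)"
proof -
  have "cos (strip_coord L \<zeta>) \<noteq> 0 \<and> tan (strip_coord L \<zeta>) \<noteq> 0" if "\<zeta> \<in> S" for \<zeta>
    using assms[OF that] abs_Re_strip_coord_less[of \<zeta>] cos_nonzero_of_Re_bound
      tan_nonzero_of_Re_bound strip_coord_eq_0_iff by blast
  then show ?thesis
    unfolding strip_green_def[abs_def] strip_coord_def
    by (intro continuous_intros) (auto simp: strip_coord_def)
qed

lemma sheet_Suc_not_pole:
  assumes "\<zeta> \<in> band L"
  shows "sheet (Suc n) \<zeta> \<noteq> - of_real (L / 2)"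
proof
  assume "sheet (Suc n) \<zeta> = - of_real (L / 2)"
  then have "Im (sheet (Suc n) \<zeta>) = 0" by simp
  moreover have "0 < pi * real (Suc n) / 4" by simp
  ultimately show False using Im_sheet_ge[OF assms, of "Suc n"] by linarith
qed

text \<open>By the Weierstrass test. The band contains the pole -L/2, and continuity extends to it
  because every sheet other than number 0 misses the pole.\<close>

lemma continuous_on_green_tail: "continuous_on (band L) (green_tail L)"
proof (rule uniform_limit_theorem)
  show "uniform_limit (band L) (\<lambda>n \<zeta>. \<Sum>i<n. strip_green L (sheet (Suc i) \<zeta>)) (green_tail L) sequentially"
    unfolding green_tail_def[abs_def]
    by (intro Weierstrass_m_test[OF strip_green_sheet_norm_le summable_tail_coeff])
  have "continuous_on (band L) (\<lambda>\<zeta>. strip_green L (sheet (Suc i) \<zeta>))" for i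
  proof (rule continuous_on_compose2[of "sheet (Suc i) ` band L" "strip_green L"])
    show "continuous_on (sheet (Suc i) ` band L) (strip_green L)"
      using sheet_Suc_not_pole by (intro continuous_on_strip_green) (auto simp: band_def)
    show "continuous_on (band L) (sheet (Suc i))"
      unfolding sheet_def[abs_def] by (intro continuous_intros)
  qed auto
  then show "\<forall>\<^sub>F n in sequentially. continuous_on (band L) (\<lambda>\<zeta>. \<Sum>i<n. strip_green L (sheet (Suc i) \<zeta>))"
    by (intro always_eventually allI continuous_on_sum)
qed auto

text \<open>Nonnegative terms turn the series into an unconditional sum, which equals the sum over
  the fibre. The value depends on exp \<zeta> alone, so any branch of the logarithm may be used
  locally.\<close>

lemma annulus_green_sums:
  assumes "\<zeta> \<in> band L"
  shows "(\<lambda>n. strip_green L (sheet n \<zeta>)) sums annulus_green L (exp \<zeta>)"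
proof -
  have s: "summable (\<lambda>n. strip_green L (sheet n \<zeta>))"
    using summable_strip_green_sheet[OF assms] by (subst (asm) summable_Suc_iff)
  have "((\<lambda>n. strip_green L (sheet n \<zeta>)) has_sum (\<Sum>n. strip_green L (sheet n \<zeta>))) UNIV"
    using assms by (intro sums_nonneg_imp_has_sum summable_sums s strip_green_nonneg)
      (auto simp: band_def)
  then have "infsum (\<lambda>n. strip_green L (sheet n \<zeta>)) UNIV = (\<Sum>n. strip_green L (sheet n \<zeta>))"
    by (rule infsumI)
  then show ?thesis
    unfolding annulus_green_def using infsum_reindex_bij_betw[OF bij_betw_sheet, of "strip_green L"] s
    by (metis summable_sums)
qed

lemma annulus_green_exp:
  assumes "\<zeta> \<in> band L"
  shows "annulus_green L (exp \<zeta>) = strip_green L \<zeta> + green_tail L \<zeta>"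
  using suminf_split_head[OF sums_summable[OF annulus_green_sums[OF assms]]]
    sums_unique[OF annulus_green_sums[OF assms]]
  by (simp add: green_tail_def)

end


section \<open>The Green function of the annulus\<close>

definition log_branch :: "complex \<Rightarrow> complex \<Rightarrow> complex" where
  "log_branch a z = Ln (z / a) + Ln a"

text \<open>z / a stays within distance 1 of 1, so on this ball \<open>Ln (z / a)\<close> avoids the
  cut even when \<open>a\<close> lies on it.\<close>

lemma Re_divide_pos:
  assumes "z \<in> ball a (cmod a)"
  shows "0 < Re (z / a)"
proof -
  have a: "a \<noteq> 0" using assms by auto
  have "cmod (1 - z / a) = cmod (a - z) / cmod a"
    using a by (simp add: field_simps flip: norm_divide)
  also have "\<dots> < 1" using assms a by (simp add: dist_norm)
  finally have "cmod (1 - z / a) < 1" .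
  then have "Re (1 - z / a) < 1"
    using complex_Re_le_cmod[of "1 - z / a"] by linarith
  then show ?thesis by simp
qed

lemma
  assumes z: "z \<in> ball a (cmod a)"
  shows exp_log_branch: "exp (log_branch a z) = z"
    and Im_log_branch: "\<bar>Im (log_branch a z)\<bar> < 3 * pi / 2"
    and Re_log_branch: "Re (log_branch a z) = ln (cmod z)"
proof -
  have a: "a \<noteq> 0" using z by auto
  have q: "0 < Re (z / a)" by (rule Re_divide_pos[OF z])
  then have q0: "z / a \<noteq> 0" by auto
  show e: "exp (log_branch a z) = z"
    using a q0 by (simp add: log_branch_def exp_add)
  \<comment> \<open>pi / 2 from the quotient and pi from \<open>Ln a\<close> add up to the
    half-width of \<open>band\<close>.\<close>
  have "\<bar>Im (Ln (z / a))\<bar> < pi / 2" using q q0 Re_Ln_pos_lt by blast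
  moreover have "\<bar>Im (Ln a)\<bar> \<le> pi" using Im_Ln_le_pi[OF a] mpi_less_Im_Ln[OF a] by linarith
  ultimately show "\<bar>Im (log_branch a z)\<bar> < 3 * pi / 2"
    unfolding log_branch_def plus_complex.sel by linarith
  show "Re (log_branch a z) = ln (cmod z)"
    using norm_exp_eq_Re[of "log_branch a z"] by (simp add: e)
qed

lemma holomorphic_log_branch: "log_branch a holomorphic_on ball a (cmod a)"
proof (cases "a = 0")
  case False
  have "z / a \<notin> \<real>\<^sub>\<le>\<^sub>0" if "z \<in> ball a (cmod a)" for z
    using Re_divide_pos[OF that] by (auto simp: complex_nonpos_Reals_iff)
  then show ?thesis
    unfolding log_branch_def[abs_def] using False by (intro holomorphic_intros) auto
qed (simp add: holomorphic_on_def)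

text \<open>Since \<open>ln 0 = 0\<close>, \<open>annulus_green\<close> has a meaningless finite
  value at the pole; a competitor must be -\<infinity> there.\<close>

definition annulus_green_pole :: "real \<Rightarrow> complex \<Rightarrow> ereal" where
  "annulus_green_pole L z
     = (if z = of_real (exp (- (L / 2))) then -\<infinity> else ereal (- annulus_green L z))"

section \<open>The sum over sheets as a function on the annulus\<close>

context
  fixes L :: real
  assumes L: "0 < L"
begin

private abbreviation "A \<equiv> annulus (exp (- L))"
private abbreviation "w \<equiv> complex_of_real (exp (- (L / 2)))"

lemma w_in_A: "w \<in> A"
  using L by (simp add: annulus_def)

text \<open>The origin lies outside the annulus, so each ball inside it is small enough to carry
  \<open>log_branch a\<close>.\<close>

lemma ball_subset_annulus_le:
  assumes "ball a \<rho> \<subseteq> A" "0 < \<rho>"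
  shows "ball a \<rho> \<subseteq> ball a (cmod a)"
proof -
  have "0 \<notin> A" by (simp add: annulus_def not_less)
  then have "0 \<notin> ball a \<rho>" using assms by blast
  then show ?thesis by (intro subset_ball) simp
qed

lemma log_branch_in_band:
  assumes "z \<in> ball a (cmod a)" "z \<in> A"
  shows "log_branch a z \<in> band L"
proof -
  have z: "exp (- L) < cmod z" "cmod z < 1" using assms(2) by (auto simp: annulus_def)
  then have "0 < cmod z" using less_trans[OF exp_gt_zero] by blast
  then have "ln (exp (- L)) < ln (cmod z)" "ln (cmod z) < 0"
    using z by (simp_all only: ln_less_cancel_iff[OF exp_gt_zero] ln_less_zero)
  then show ?thesis
    using Im_log_branch[OF assms(1)] by (simp add: band_def Re_log_branch[OF assms(1)])
qed

lemma log_branch_not_pole: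
  assumes "z \<in> ball a (cmod a)" "z \<noteq> w"
  shows "log_branch a z \<noteq> - of_real (L / 2)"
proof
  assume "log_branch a z = - of_real (L / 2)"
  then have "z = exp (of_real (- (L / 2)))"
    using exp_log_branch[OF assms(1)] by simp
  then show False using assms(2) by (simp flip: exp_of_real)
qed

lemma annulus_green_branch:
  assumes "z \<in> ball a (cmod a)" "z \<in> A"
  shows "annulus_green L z = strip_green L (log_branch a z) + green_tail L (log_branch a z)"
  using annulus_green_exp[OF L log_branch_in_band[OF assms]] by (simp add: exp_log_branch[OF assms(1)])

lemma self_branch:
  assumes "z \<in> A"
  shows "z \<in> ball z (cmod z)"
  using assms by (auto simp: annulus_def intro: less_trans[OF exp_gt_zero])

lemma annulus_green_pos:
  assumes "z \<in> A" "z \<noteq> w"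
  shows "0 < annulus_green L z"
proof -
  note b = self_branch[OF assms(1)]
  note band = log_branch_in_band[OF b assms(1)]
  have "0 < strip_green L (log_branch z z)"
    using band log_branch_not_pole[OF b assms(2)]
    by (intro strip_green_pos[OF L]) (auto simp: band_def)
  then show ?thesis
    using green_tail_nonneg[OF L band] by (simp add: annulus_green_branch[OF b assms(1)])
qed

lemma suminf_tail_coeff_nonneg: "0 \<le> suminf (tail_coeff L)"
  by (intro suminf_nonneg summable_tail_coeff[OF L]) (simp add: tail_coeff_def)

text \<open>The quantitative form of boundary values 0: the constant 2 accounts for sheet 0, the
  series for all others.\<close>

lemma annulus_green_le_boundary:
  assumes z: "z \<in> A" and c: "cos (pi * (ln (cmod z) / L + 1 / 2)) \<le> 1 / 2"
  shows "annulus_green L z \<le> cos (pi * (ln (cmod z) / L + 1 / 2)) * (2 + suminf (tail_coeff L))"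
proof -
  note b = self_branch[OF z]
  note band = log_branch_in_band[OF b z]
  note re = Re_log_branch[OF b]
  have "strip_green L (log_branch z z) \<le> 2 * cos (pi * (ln (cmod z) / L + 1 / 2))"
    using strip_green_le_boundary[OF L, of "log_branch z z"] band c by (simp add: band_def re)
  moreover have "green_tail L (log_branch z z)
      \<le> cos (pi * (ln (cmod z) / L + 1 / 2)) * suminf (tail_coeff L)"
    using green_tail_le[OF L band] by (simp add: re)
  ultimately show ?thesis
    by (simp add: annulus_green_branch[OF b z] algebra_simps)
qed

lemma open_punctured: "open (A - {w})"
  by (intro open_Diff open_annulus) auto

lemma continuous_on_annulus_green: "continuous_on (A - {w}) (annulus_green L)"
proof (intro continuous_at_imp_continuous_on ballI)
  fix a assume a: "a \<in> A - {w}"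
  then obtain \<rho> where \<rho>: "0 < \<rho>" "ball a \<rho> \<subseteq> A - {w}"
    using open_punctured open_contains_ball by blast
  have sub: "ball a \<rho> \<subseteq> ball a (cmod a)"
    using ball_subset_annulus_le[of a \<rho>] \<rho> by blast
  have lb: "continuous_on (ball a \<rho>) (log_branch a)"
    using holomorphic_on_imp_continuous_on[OF holomorphic_log_branch] sub
    by (rule continuous_on_subset)
  have band: "log_branch a ` ball a \<rho> \<subseteq> band L"
    using log_branch_in_band sub \<rho> by blast
  have pole: "- of_real (L / 2) \<notin> log_branch a ` ball a \<rho>"
  proof
    assume "- of_real (L / 2) \<in> log_branch a ` ball a \<rho>"
    then obtain z where z: "z \<in> ball a \<rho>" "log_branch a z = - of_real (L / 2)" by auto
    then have "z \<in> ball a (cmod a)" "z \<noteq> w" using sub \<rho> by auto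
    then have "log_branch a z \<noteq> - of_real (L / 2)" by (rule log_branch_not_pole)
    with z(2) show False by contradiction
  qed
  have "continuous_on (ball a \<rho>) (\<lambda>z. strip_green L (log_branch a z) + green_tail L (log_branch a z))"
  proof (rule continuous_on_add)
    have "continuous_on (log_branch a ` ball a \<rho>) (strip_green L)"
    proof (rule continuous_on_strip_green[OF L])
      fix \<zeta> assume \<zeta>: "\<zeta> \<in> log_branch a ` ball a \<rho>"
      then have "\<zeta> \<in> band L" using band by (rule subsetD[rotated])
      moreover have "\<zeta> \<noteq> - of_real (L / 2)" using \<zeta> pole by metis
      ultimately show "- L < Re \<zeta> \<and> Re \<zeta> < 0 \<and> \<zeta> \<noteq> - of_real (L / 2)"
        by (simp add: band_def)
    qed
    then show "continuous_on (ball a \<rho>) (\<lambda>z. strip_green L (log_branch a z))"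
      using lb by (rule continuous_on_compose2) auto
    show "continuous_on (ball a \<rho>) (\<lambda>z. green_tail L (log_branch a z))"
      using continuous_on_green_tail[OF L] lb band by (rule continuous_on_compose2)
  qed
  then have "continuous_on (ball a \<rho>) (annulus_green L)"
    by (rule continuous_on_eq) (use annulus_green_branch sub \<rho> in \<open>auto simp: subset_iff\<close>)
  then show "isCont (annulus_green L) a"
    using \<rho>(1) by (simp add: continuous_on_eq_continuous_at)
qed

text \<open>On each sheet the summand is -ln of the modulus of a nonvanishing holomorphic function.
  The summands are nonnegative, so monotone convergence carries the mean value property to the
  sum.\<close>

lemma annulus_green_mean_value:
  assumes \<rho>: "ball a \<rho> \<subseteq> A - {w}" and s: "0 < s" "s < \<rho>"
  shows "((\<lambda>t. annulus_green L (a + of_real s * cis t)) has_integral 2 * pi * annulus_green L a) {0..2*pi}"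
proof -
  have sub: "ball a \<rho> \<subseteq> ball a (cmod a)"
    using ball_subset_annulus_le[of a \<rho>] \<rho> s by auto
  have band: "log_branch a z \<in> band L" if "z \<in> ball a \<rho>" for z
    using log_branch_in_band sub \<rho> that by blast
  have sums: "(\<lambda>n. strip_green L (sheet n (log_branch a z))) sums annulus_green L z"
    if "z \<in> ball a \<rho>" for z
    using annulus_green_sums[OF L band[OF that]] exp_log_branch sub that by auto
  have circ: "a + of_real s * cis t \<in> ball a \<rho>" for t
    using s by (simp add: dist_norm norm_mult)
  have aball: "a \<in> ball a \<rho>" using s by simp
  have nonneg: "0 \<le> strip_green L (sheet n (log_branch a z))" if "z \<in> ball a \<rho>" for n z
    using band[OF that] by (intro strip_green_nonneg[OF L]) (auto simp: band_def)
  have mean: "((\<lambda>t. strip_green L (sheet n (log_branch a (a + of_real s * cis t))))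
      has_integral 2 * pi * strip_green L (sheet n (log_branch a a))) {0..2*pi}" for n
  proof -
    define f where "f z = tan (strip_coord L (sheet n (log_branch a z)))" for z
    have sc: "\<bar>Re (strip_coord L (sheet n (log_branch a z)))\<bar> < pi / 4" if "z \<in> ball a \<rho>" for z
      using band[OF that] by (intro abs_Re_strip_coord_less[OF L]) (auto simp: band_def)
    have "f holomorphic_on ball a \<rho>"
      unfolding f_def[abs_def] tan_def strip_coord_def sheet_def
      using cos_nonzero_of_Re_bound[OF sc] holomorphic_on_subset[OF holomorphic_log_branch sub]
      by (intro holomorphic_intros) (auto simp: strip_coord_def sheet_def)
    moreover have "f z \<noteq> 0" if z: "z \<in> ball a \<rho>" for z
    proof -
      have "sheet n (log_branch a z) \<noteq> - of_real (L / 2)"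
      proof (cases n)
        case 0
        then show ?thesis using log_branch_not_pole sub \<rho> z by (simp add: subset_iff)
      next
        case (Suc k)
        then show ?thesis using sheet_Suc_not_pole[OF L band[OF z]] by simp
      qed
      then show ?thesis
        unfolding f_def using sc[OF z] by (intro tan_nonzero_of_Re_bound)
          (simp_all add: strip_coord_eq_0_iff[OF L])
    qed
    ultimately have "((\<lambda>t. ln (cmod (f (a + of_real s * cis t)))) has_integral 2 * pi * ln (cmod (f a)))
        {0..2*pi}"
      using s by (rule ln_cmod_mean_value)
    from has_integral_neg[OF this] show ?thesis
      by (simp add: strip_green_def f_def)
  qed
  show ?thesis
  proof (rule has_integral_monotone_convergence_increasing)
    fix k
    show "((\<lambda>t. \<Sum>n<k. strip_green L (sheet n (log_branch a (a + of_real s * cis t))))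
        has_integral (\<Sum>n<k. 2 * pi * strip_green L (sheet n (log_branch a a)))) {0..2*pi}"
      by (intro has_integral_sum mean) auto
    show "(\<Sum>n<k. strip_green L (sheet n (log_branch a (a + of_real s * cis t))))
        \<le> (\<Sum>n<Suc k. strip_green L (sheet n (log_branch a (a + of_real s * cis t))))" for t
      using nonneg[OF circ] by simp
  next
    show "(\<lambda>k. \<Sum>n<k. strip_green L (sheet n (log_branch a (a + of_real s * cis t))))
        \<longlonglongrightarrow> annulus_green L (a + of_real s * cis t)" for t
      using sums[OF circ] by (simp add: sums_def)
    show "(\<lambda>k. \<Sum>n<k. 2 * pi * strip_green L (sheet n (log_branch a a))) \<longlonglongrightarrow> 2 * pi * annulus_green L a"
      using sums_mult[OF sums[OF aball], of "2 * pi"] by (simp add: sums_def)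
  qed
qed

lemma eventually_at_w_in_A: "\<forall>\<^sub>F z in at w. z \<in> A - {w}"
  using eventually_at_in_open[OF open_annulus w_in_A] by simp

text \<open>Only sheet 0 is singular at \<open>w\<close>. With \<open>T\<close> the tangent in the
  logarithmic coordinate, its contribution is ln |T z / (z - w)|, a difference quotient since
  \<open>T w = 0\<close>; the limit is the logarithm of the modulus of the derivative.\<close>

lemma annulus_green_log_limit:
  "((\<lambda>z. - annulus_green L z - ln (cmod (z - w))) \<longlongrightarrow>
     ln (pi / (2 * L * exp (- (L / 2)))) - green_tail L (- of_real (L / 2))) (at w)"
proof -
  have w0: "w \<noteq> 0" by simp
  have ball_w: "w \<in> ball w (cmod w)" by simp
  have lw: "log_branch w w = - of_real (L / 2)"
    by (simp add: log_branch_def Ln_of_real)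
  have ev: "\<forall>\<^sub>F z in at w. z \<in> A - {w} \<and> z \<in> ball w (cmod w)"
    using eventually_at_w_in_A eventually_at_in_open'[of "ball w (cmod w)" w] by (auto elim: eventually_elim2)
  have tail: "((\<lambda>z. green_tail L (log_branch w z)) \<longlongrightarrow> green_tail L (- of_real (L / 2))) (at w)"
  proof -
    have "continuous_on (A \<inter> ball w (cmod w)) (\<lambda>z. green_tail L (log_branch w z))"
      using log_branch_in_band
      by (intro continuous_on_compose2[OF continuous_on_green_tail[OF L]]
          continuous_on_subset[OF holomorphic_on_imp_continuous_on[OF holomorphic_log_branch]]) auto
    then have "isCont (\<lambda>z. green_tail L (log_branch w z)) w"
      using w_in_A ball_w open_annulus
      by (subst (asm) continuous_on_eq_continuous_at) auto
    then show ?thesis by (simp only: isCont_def lw)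
  qed
  define T where "T z = tan (strip_coord L (log_branch w z))" for z
  have c0: "strip_coord L (log_branch w w) = 0" unfolding lw strip_coord_eq_0_iff[OF L] ..
  then have Tw: "T w = 0" by (simp only: T_def tan_zero)
  have "(T has_field_derivative of_real (pi / (2 * L)) * (1 / w)) (at w)"
  proof -
    have 1: "(log_branch w has_field_derivative 1 / w) (at w)"
      unfolding log_branch_def[abs_def] using w0 by (auto intro!: derivative_eq_intros)
    have 2: "((\<lambda>z. strip_coord L (log_branch w z)) has_field_derivative of_real (pi / (2 * L)) * (1 / w)) (at w)"
      unfolding strip_coord_def
      using DERIV_cmult[OF DERIV_add[OF 1 DERIV_const[of "of_real (L / 2)"]], of "of_real (pi / (2 * L))"]
      by (simp only: add_0_right)
    show ?thesis
      unfolding T_def[abs_def]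
      using DERIV_chain2[OF DERIV_tan 2] unfolding c0 by simp
  qed
  then have "((\<lambda>z. T z / (z - w)) \<longlongrightarrow> of_real (pi / (2 * L)) * (1 / w)) (at w)"
    unfolding has_field_derivative_iff Tw diff_zero .
  then have "((\<lambda>z. ln (cmod (T z / (z - w)))) \<longlongrightarrow> ln (cmod (of_real (pi / (2 * L)) * (1 / w)))) (at w)"
    using L w0 by (intro tendsto_ln tendsto_norm) auto
  also have "cmod (of_real (pi / (2 * L)) * (1 / w)) = pi / (2 * L * exp (- (L / 2)))"
    using L by (simp add: norm_mult norm_divide)
  finally have "((\<lambda>z. ln (cmod (T z / (z - w))) - green_tail L (log_branch w z)) \<longlongrightarrow>
      ln (pi / (2 * L * exp (- (L / 2)))) - green_tail L (- of_real (L / 2))) (at w)"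
    using tail by (rule tendsto_diff)
  then show ?thesis
  proof (rule Lim_transform_eventually)
    show "\<forall>\<^sub>F z in at w. ln (cmod (T z / (z - w))) - green_tail L (log_branch w z)
        = - annulus_green L z - ln (cmod (z - w))"
      using ev
    proof eventually_elim
      case (elim z)
      then have z: "z \<in> A" "z \<noteq> w" "z \<in> ball w (cmod w)" by auto
      have "T z \<noteq> 0"
        unfolding T_def using log_branch_in_band[OF z(3,1)] log_branch_not_pole[OF z(3,2)]
        by (intro tan_nonzero_of_Re_bound abs_Re_strip_coord_less[OF L])
          (auto simp: band_def strip_coord_eq_0_iff[OF L])
      then show ?case
        using z by (simp add: annulus_green_branch[OF z(3,1)] strip_green_def T_def norm_divide ln_div)
    qed
  qed
qed

text \<open>The upper bound makes the sum a competitor; the lower one lets it dominate other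
  competitors near the pole.\<close>

lemma eventually_annulus_green_bounds:
  obtains C where "\<forall>\<^sub>F z in at w. - annulus_green L z \<le> ln (cmod (z - w)) + C"
    "\<forall>\<^sub>F z in at w. ln (cmod (z - w)) - C \<le> - annulus_green L z"
proof -
  define l where "l = ln (pi / (2 * L * exp (- (L / 2)))) - green_tail L (- of_real (L / 2))"
  note lim = annulus_green_log_limit[folded l_def]
  have "\<forall>\<^sub>F z in at w. - annulus_green L z \<le> ln (cmod (z - w)) + (\<bar>l\<bar> + 1)"
    using order_tendstoD(2)[OF lim, of "l + 1"] by (auto elim!: eventually_mono)
  moreover have "\<forall>\<^sub>F z in at w. ln (cmod (z - w)) - (\<bar>l\<bar> + 1) \<le> - annulus_green L z"
    using order_tendstoD(1)[OF lim, of "l - 1"] by (auto elim!: eventually_mono)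
  ultimately show ?thesis by (rule that)
qed

section \<open>Semicontinuity and subharmonicity of the sum\<close>

lemma filterlim_ln_cmod_at: "filterlim (\<lambda>z. ln (cmod (z - a))) at_bot (at a)"
proof -
  have "((\<lambda>z. cmod (z - a)) \<longlongrightarrow> cmod (a - a)) (at a)"
    by (intro tendsto_intros)
  then have "filterlim (\<lambda>z. cmod (z - a)) (at_right 0) (at a)"
    unfolding filterlim_at by (simp add: eventually_at_filter)
  then show ?thesis
    by (rule filterlim_compose[OF ln_at_0])
qed

lemma open_annulus_green_pole_less: "open {z\<in>A. annulus_green_pole L z < c}"
proof (cases c)
  case PInf
  have "annulus_green_pole L z < \<infinity>" for z by (simp add: annulus_green_pole_def)
  then have "{z\<in>A. annulus_green_pole L z < c} = A" using PInf by auto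
  then show ?thesis using open_annulus by simp
next
  case MInf
  then show ?thesis by simp
next
  case (real c')
  define U where "U = {z \<in> A - {w}. - annulus_green L z < c'}"
  have "open ((A - {w}) \<inter> (\<lambda>z. - annulus_green L z) -` {..<c'})"
    by (intro continuous_open_preimage continuous_intros continuous_on_annulus_green
        open_punctured open_lessThan)
  also have "(A - {w}) \<inter> (\<lambda>z. - annulus_green L z) -` {..<c'} = U"
    by (auto simp: U_def)
  finally have U: "open U" .
  obtain C where "\<forall>\<^sub>F z in at w. - annulus_green L z \<le> ln (cmod (z - w)) + C"
    using eventually_annulus_green_bounds by blast
  moreover have "\<forall>\<^sub>F z in at w. ln (cmod (z - w)) < c' - C"
    using filterlim_ln_cmod_at[of w] by (simp only: filterlim_at_bot_dense)
  ultimately have "\<forall>\<^sub>F z in at w. z \<in> U"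
    using eventually_at_w_in_A by eventually_elim (auto simp: U_def)
  then obtain e where e: "0 < e" "\<And>z. z \<noteq> w \<Longrightarrow> dist z w < e \<Longrightarrow> z \<in> U"
    by (auto simp: eventually_at)
  have "{z\<in>A. annulus_green_pole L z < c} = U \<union> {w}"
    using w_in_A real by (auto simp: annulus_green_pole_def U_def)
  \<comment> \<open>The function tends to -\<infinity> at \<open>w\<close>, so a whole punctured
    ball lies in \<open>U\<close>, and adding the centre keeps the set open.\<close>
  also have "\<dots> = U \<union> ball w e"
  proof -
    have "x \<in> U \<union> {w}" if "x \<in> ball w e" for x
      using e(2)[of x] that by (cases "x = w") (auto simp: dist_commute)
    then have "ball w e \<subseteq> U \<union> {w}" by blast
    moreover have "w \<in> ball w e" using e(1) by simp
    ultimately show ?thesis by blast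
  qed
  finally show ?thesis using U by (simp add: open_Un)
qed

lemma subharmonic_annulus_green_pole: "subharmonic_on (annulus_green_pole L) A"
  unfolding subharmonic_on_def
proof (intro conjI ballI allI)
  show "annulus_green_pole L z < \<infinity>" for z by (simp add: annulus_green_pole_def)
  show "openin (top_of_set A) {z\<in>A. annulus_green_pole L z < c}" for c
    using open_annulus_green_pole_less by (intro open_subset) auto
next
  fix a assume a: "a \<in> A"
  show "\<exists>\<rho>>0. ball a \<rho> \<subseteq> A \<and>
      (\<forall>s. 0 < s \<and> s < \<rho> \<longrightarrow> annulus_green_pole L a \<le> circle_mean (annulus_green_pole L) a s)"
  proof (cases "a = w")
    case True
    then have "annulus_green_pole L a = -\<infinity>" by (simp add: annulus_green_pole_def)
    moreover obtain \<rho> where "0 < \<rho>" "ball a \<rho> \<subseteq> A"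
      using a open_annulus open_contains_ball by blast
    ultimately show ?thesis by auto
  next
    case False
    then obtain \<rho> where \<rho>: "0 < \<rho>" "ball a \<rho> \<subseteq> A - {w}"
      using open_punctured a open_contains_ball by (metis Diff_iff singletonD)
    have "annulus_green_pole L a \<le> circle_mean (annulus_green_pole L) a s" if s: "0 < s" "s < \<rho>" for s
    proof -
      have sph: "sphere a s \<subseteq> A - {w}" using s \<rho> by auto
      have "((\<lambda>t. - annulus_green L (a + of_real s * cis t)) has_integral
          2 * pi * (- annulus_green L a)) {0..2*pi}"
        using has_integral_neg[OF annulus_green_mean_value[OF \<rho>(2) s]] by simp
      then have "ereal (- annulus_green L a) = circle_mean (\<lambda>z. ereal (- annulus_green L z)) a s"
        using s by (intro circle_mean_ereal[symmetric] continuous_intros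
            continuous_on_subset[OF continuous_on_annulus_green sph]) auto
      also have "\<dots> \<le> circle_mean (annulus_green_pole L) a s"
        using s sph by (intro circle_mean_mono) (auto simp: annulus_green_pole_def)
      finally show ?thesis using False by (simp add: annulus_green_pole_def)
    qed
    then show ?thesis using \<rho> by blast
  qed
qed

lemma annulus_green_pole_competitor: "annulus_green_pole L \<in> green_competitors A w"
  unfolding green_competitors_def
proof (intro CollectI conjI ballI)
  show "annulus_green_pole L z < 0" if "z \<in> A" for z
    using annulus_green_pos[OF that] by (simp add: annulus_green_pole_def)
  obtain C where C: "\<forall>\<^sub>F z in at w. - annulus_green L z \<le> ln (cmod (z - w)) + C"
    using eventually_annulus_green_bounds by blast
  then have "\<forall>\<^sub>F z in at w. annulus_green_pole L z \<le> ereal (ln (cmod (z - w)) + C)"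
    using eventually_at_w_in_A by eventually_elim (simp add: annulus_green_pole_def)
  then show "\<exists>C. \<forall>\<^sub>F z in at w. annulus_green_pole L z \<le> ereal (ln (cmod (z - w)) + C)" ..
qed (rule subharmonic_annulus_green_pole)

section \<open>Domination of all competitors\<close>

text \<open>The factor \<open>1 - \<epsilon>\<close> makes the pole of the comparison function weaker than that of \<open>u\<close>,
  and the term \<open>- (\<delta> / 2) |z|\<^sup>2\<close> makes it strictly superharmonic.\<close>

lemma green_competitor_le_perturbed:
  assumes u: "u \<in> green_competitors A w" and z: "z \<in> A - {w}"
    and e: "0 < \<epsilon>" "\<epsilon> < 1" and d: "0 < \<delta>"
  shows "u z \<le> ereal ((1 - \<epsilon>) * (- annulus_green L z) + \<delta> - \<delta> / 2 * (cmod z)\<^sup>2)"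
proof -
  define \<phi> where "\<phi> z = (1 - \<epsilon>) * (- annulus_green L z) + \<delta> - \<delta> / 2 * (cmod z)\<^sup>2" for z
  define \<kappa> where "\<kappa> z = cos (pi * (ln (cmod z) / L + 1 / 2))" for z :: complex
  define S where "S = suminf (tail_coeff L)"
  \<comment> \<open>The level of \<kappa> below which the boundary estimate applies and gives
    \<open>annulus_green\<close> \<le> \<delta> / 2.\<close>
  define c where "c = min (1 / 2) (\<delta> / (2 * (2 + S)))"
  have S: "0 \<le> S" using suminf_tail_coeff_nonneg by (simp add: S_def)
  have c: "0 < c" "c \<le> 1 / 2" "c * (2 + S) \<le> \<delta> / 2"
  proof -
    show "0 < c" using S d by (simp add: c_def)
    show "c \<le> 1 / 2" unfolding c_def by (rule min.cobounded1)
    have "c * (2 + S) \<le> \<delta> / (2 * (2 + S)) * (2 + S)"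
      using S by (intro mult_right_mono) (auto simp: c_def)
    also have "\<dots> = \<delta> / 2"
    proof -
      have "2 + S \<noteq> 0" using S by linarith
      then show ?thesis by (metis divide_divide_eq_left nonzero_eq_divide_eq)
    qed
    finally show "c * (2 + S) \<le> \<delta> / 2" .
  qed
  have sub: "subharmonic_on u A" and neg: "\<And>z. z \<in> A \<Longrightarrow> u z < 0"
    using u by (auto simp: green_competitors_def)
  have sq: "\<delta> / 2 * (cmod x)\<^sup>2 \<le> \<delta> / 2" if "x \<in> A" for x
    using that d by (simp add: annulus_def power_le_one)
  have near: "\<forall>\<^sub>F x in at w. u x \<le> ereal (\<phi> x)"
  proof -
    obtain C1 where C1: "\<forall>\<^sub>F x in at w. u x \<le> ereal (ln (cmod (x - w)) + C1)"
      using u by (auto simp: green_competitors_def)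
    obtain C2 where C2: "\<forall>\<^sub>F x in at w. ln (cmod (x - w)) - C2 \<le> - annulus_green L x"
      using eventually_annulus_green_bounds by blast
    \<comment> \<open>The threshold solves \<open>ln t + C1 = (1 - \<epsilon>) * (ln t - C2)\<close>
      for \<open>ln t\<close>; below it the weaker pole wins over both constants.\<close>
    have "\<forall>\<^sub>F x in at w. ln (cmod (x - w)) < (- C1 - (1 - \<epsilon>) * C2) / \<epsilon>"
      using filterlim_ln_cmod_at[of w] by (simp only: filterlim_at_bot_dense)
    with C1 C2 eventually_at_w_in_A show ?thesis
    proof eventually_elim
      case (elim x)
      have "\<epsilon> * ln (cmod (x - w)) \<le> - C1 - (1 - \<epsilon>) * C2"
        using elim(4) e by (simp add: field_simps)
      moreover have "(1 - \<epsilon>) * (ln (cmod (x - w)) - C2) \<le> (1 - \<epsilon>) * (- annulus_green L x)"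
        using elim(2) e by (intro mult_left_mono) auto
      moreover have "\<delta> / 2 * (cmod x)\<^sup>2 \<le> \<delta>" using sq[of x] elim(3) d by auto
      ultimately have "ln (cmod (x - w)) + C1 \<le> \<phi> x"
        by (simp add: \<phi>_def algebra_simps)
      then show ?case using elim(1) by (meson ereal_less_eq(3) order_trans)
    qed
  qed
  then obtain \<rho> where \<rho>: "0 < \<rho>" "\<And>x. x \<noteq> w \<Longrightarrow> dist x w < \<rho> \<Longrightarrow> u x \<le> ereal (\<phi> x)"
    by (auto simp: eventually_at)
  define R where "R = {x. exp (- L) \<le> cmod x \<and> cmod x \<le> 1}"
  have R: "compact R"
  proof -
    have "R = cball 0 1 - ball 0 (exp (- L))" by (auto simp: R_def)
    then show ?thesis by (simp add: compact_diff)
  qed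
  have \<kappa>: "continuous_on R \<kappa>"
    unfolding \<kappa>_def[abs_def]
    using less_le_trans[OF exp_gt_zero, of "- L"] L
    by (intro continuous_intros) (force simp: R_def)+
  \<comment> \<open>Since \<kappa> vanishes on both boundary circles, this set is compact inside the
    punctured annulus. Off it a point is either close to \<open>w\<close> or has \<kappa> < c, where
    u < 0 \<le> \<phi>.\<close>
  define K where "K = (R \<inter> \<kappa> -` {c..}) \<inter> - ball w \<rho>"
  have K: "compact K"
    unfolding K_def using continuous_closed_preimage[OF \<kappa> compact_imp_closed[OF R] closed_atLeast] R
    by (metis Int_assoc closed_Compl compact_Int_closed open_ball inf_left_idem)
  have KV: "K \<subseteq> A - {w}"
  proof
    fix x assume x: "x \<in> K"
    then have xR: "exp (- L) \<le> cmod x" "cmod x \<le> 1" "c \<le> \<kappa> x" "x \<noteq> w"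
      using \<rho> by (auto simp: K_def R_def)
    have "\<kappa> x = 0" if "cmod x = exp (- L) \<or> cmod x = 1"
      using that L by (auto simp: \<kappa>_def)
    with xR c show "x \<in> A - {w}" by (force simp: annulus_def)
  qed
  have "u z \<le> ereal (\<phi> z)"
  proof (rule subharmonic_le_strict_superharmonic[OF sub open_punctured _ _ _ K KV _ z])
    show "continuous_on (A - {w}) \<phi>"
      unfolding \<phi>_def[abs_def] by (intro continuous_intros continuous_on_annulus_green)
  next
    fix a assume "a \<in> A - {w}"
    then obtain \<rho>' where \<rho>': "0 < \<rho>'" "ball a \<rho>' \<subseteq> A - {w}"
      using open_punctured open_contains_ball by metis
    have "((\<lambda>t. \<phi> (a + of_real s * cis t)) has_integral 2 * pi * (\<phi> a - \<delta> / 2 * s\<^sup>2)) {0..2*pi}"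
      if s: "0 < s" "s < \<rho>'" for s
    proof -
      have "((\<lambda>t. (1 - \<epsilon>) * (- annulus_green L (a + of_real s * cis t)) + \<delta>
          - \<delta> / 2 * (cmod (a + of_real s * cis t))\<^sup>2) has_integral
          (1 - \<epsilon>) * (- (2 * pi * annulus_green L a)) + (2 * pi - 0) *\<^sub>R \<delta>
          - \<delta> / 2 * (2 * pi * ((cmod a)\<^sup>2 + s\<^sup>2))) {0..2*pi}"
        using s by (intro has_integral_diff has_integral_add has_integral_mult_right has_integral_neg
            annulus_green_mean_value[OF \<rho>'(2)] mean_value_norm_square) (use has_integral_const_real[of \<delta> 0 "2*pi"] in auto)
      then show ?thesis
        by (simp add: \<phi>_def algebra_simps)
    qed
    moreover have "\<phi> a - \<delta> / 2 * s\<^sup>2 < \<phi> a" if "0 < s" for s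
      using that d by simp
    ultimately show "\<exists>\<rho>>0. \<forall>s. 0 < s \<and> s < \<rho> \<longrightarrow>
      (\<exists>m < \<phi> a. ((\<lambda>t. \<phi> (a + of_real s * cis t)) has_integral 2 * pi * m) {0..2*pi})"
      using \<rho>'(1) by blast
  next
    fix x assume x: "x \<in> A - {w} - K"
    show "u x \<le> ereal (\<phi> x)"
    proof (cases "dist x w < \<rho>")
      case True
      then show ?thesis using \<rho>(2) x by auto
    next
      case False
      then have k: "\<kappa> x < c" using x by (auto simp: K_def R_def annulus_def dist_commute)
      have "annulus_green L x \<le> \<kappa> x * (2 + S)"
        unfolding \<kappa>_def S_def using x k c by (intro annulus_green_le_boundary) (auto simp: \<kappa>_def)
      also have "\<dots> \<le> c * (2 + S)"
        using k S by (intro mult_right_mono) auto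
      finally have g: "annulus_green L x \<le> \<delta> / 2" using c by linarith
      have "0 < annulus_green L x" using annulus_green_pos x by blast
      then have "(1 - \<epsilon>) * annulus_green L x \<le> 1 * annulus_green L x"
        using e by (intro mult_right_mono) auto
      then have "0 \<le> \<phi> x" using g sq[of x] x by (simp add: \<phi>_def)
      then show ?thesis using neg[of x] x by (meson DiffD1 ereal_less_eq(5) less_imp_le order_trans)
    qed
  qed auto
  then show ?thesis by (simp add: \<phi>_def)
qed

text \<open>Both perturbation parameters are set to the same small \<open>e\<close>, chosen so that
  the total gain \<open>e * (g + 1)\<close> is at most half of the supposed gap
  \<open>b + g\<close>.\<close>

lemma green_competitor_le:
  assumes u: "u \<in> green_competitors A w" and z: "z \<in> A - {w}"
  shows "u z \<le> ereal (- annulus_green L z)"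
proof (rule ccontr)
  assume "\<not> ?thesis"
  moreover have "u z < 0" using u z by (auto simp: green_competitors_def)
  ultimately obtain b where b: "u z = ereal b" "- annulus_green L z < b"
    by (cases "u z") auto
  define g where "g = annulus_green L z"
  have g: "0 < g" using annulus_green_pos z by (auto simp: g_def)
  define e where "e = min (1 / 2) ((b + g) / (2 * (g + 1)))"
  have e: "0 < e" "e < 1" using b g by (auto simp: e_def g_def)
  have "b \<le> (1 - e) * (- g) + e - e / 2 * (cmod z)\<^sup>2"
    using green_competitor_le_perturbed[OF u z e e(1)] by (simp add: b g_def)
  also have "\<dots> \<le> - g + e * (g + 1)" using e by (simp add: algebra_simps)
  also have "\<dots> \<le> - g + (b + g) / (2 * (g + 1)) * (g + 1)"
    using g by (intro add_left_mono mult_right_mono) (auto simp: e_def)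
  also have "\<dots> = - g + (b + g) / 2" using g by (simp add: field_simps)
  finally show False using b by (simp add: g_def)
qed

section \<open>Green function, Robin constant and capacity\<close>

lemma green_function_annulus:
  assumes z: "z \<in> A - {w}"
  shows "green_function A w z = ereal (- annulus_green L z)"
proof (rule antisym)
  show "green_function A w z \<le> ereal (- annulus_green L z)"
    unfolding green_function_def using z by (intro SUP_least green_competitor_le)
  have "ereal (- annulus_green L z) = annulus_green_pole L z"
    using z by (simp add: annulus_green_pole_def)
  also have "\<dots> \<le> green_function A w z"
    unfolding green_function_def by (intro SUP_upper annulus_green_pole_competitor)
  finally show "ereal (- annulus_green L z) \<le> green_function A w z" .
qed

lemma robin_constant_annulus:
  "robin_constant A w
     = ereal (ln (pi / (2 * L * exp (- (L / 2)))) - green_tail L (- of_real (L / 2)))"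
  unfolding robin_constant_def
proof (rule tendsto_Lim)
  have "((\<lambda>z. ereal (- annulus_green L z - ln (cmod (z - w)))) \<longlongrightarrow>
     ereal (ln (pi / (2 * L * exp (- (L / 2)))) - green_tail L (- of_real (L / 2)))) (at w)"
    using annulus_green_log_limit by (rule tendsto_ereal)
  then show "((\<lambda>z. green_function A w z - ereal (ln (cmod (z - w)))) \<longlongrightarrow>
     ereal (ln (pi / (2 * L * exp (- (L / 2)))) - green_tail L (- of_real (L / 2)))) (at w)"
    by (rule Lim_transform_eventually)
      (use eventually_at_w_in_A in eventually_elim, simp add: green_function_annulus)
qed simp

text \<open>The sheets without the pole lower the Robin constant by \<open>h\<close> \<ge> 0;
  dropping \<open>h\<close> is the whole loss in the upper bound. Positivity is recorded for the
  later division by the square.\<close>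

lemma log_capacity_annulus:
  "0 < log_capacity A w" "log_capacity A w \<le> pi / (2 * L * exp (- (L / 2)))"
proof -
  define h where "h = green_tail L (- of_real (L / 2))"
  have eq: "log_capacity A w = exp (ln (pi / (2 * L * exp (- (L / 2)))) - h)"
    by (simp add: log_capacity_def robin_constant_annulus h_def)
  then show "0 < log_capacity A w" by simp
  have "0 \<le> h"
    unfolding h_def using L pi_gt_zero by (intro green_tail_nonneg[OF L]) (simp add: band_def)
  then have "log_capacity A w \<le> exp (ln (pi / (2 * L * exp (- (L / 2)))))"
    unfolding eq by simp
  also have "\<dots> = pi / (2 * L * exp (- (L / 2)))"
    using L by (intro exp_ln) simp
  finally show "log_capacity A w \<le> pi / (2 * L * exp (- (L / 2)))" .
qed

end

theorem proposition4:
  fixes r :: real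
  assumes "0 < r" and "r < 1"
  shows "bergman_kernel (annulus r) (complex_of_real (sqrt r))
           / (log_capacity (annulus r) (complex_of_real (sqrt r)))\<^sup>2
         \<ge> - 2 * ln r / pi ^ 3"
proof -
  define L where "L = - ln r"
  define w where "w = complex_of_real (sqrt r)"
  define c where "c = log_capacity (annulus r) w"
  have L: "0 < L" using assms by (simp add: L_def)
  have r: "r = exp (- L)" using assms by (simp add: L_def)
  have sr: "sqrt r = exp (- (L / 2))"
    unfolding r by (rule real_sqrt_unique) (simp_all flip: exp_double)
  have w: "w \<in> annulus r" using w_in_A[OF L] by (simp add: w_def sr flip: r)
  have c: "0 < c" "c \<le> pi / (2 * L * sqrt r)"
    using log_capacity_annulus[OF L] by (simp_all add: c_def w_def sr flip: r)
  have "c\<^sup>2 \<le> (pi / (2 * L * sqrt r))\<^sup>2"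
    using c by (intro power_mono) auto
  also have "\<dots> = pi\<^sup>2 / (4 * L\<^sup>2 * r)"
    using assms by (simp add: power_divide power_mult_distrib)
  finally have c2: "c\<^sup>2 \<le> pi\<^sup>2 / (4 * L\<^sup>2 * r)" .
  \<comment> \<open>The constant is exactly the quotient of the two bounds; \<open>r\<close>, the
    squared modulus of the base point, cancels.\<close>
  have "- 2 * ln r / pi ^ 3 = 1 / (2 * pi * L * r) / (pi\<^sup>2 / (4 * L\<^sup>2 * r))"
    using L assms by (simp add: L_def[symmetric] field_simps power2_eq_square power3_eq_cube)
  also have "\<dots> \<le> 1 / (2 * pi * L * r) / c\<^sup>2"
    using c c2 L assms by (intro divide_left_mono) auto
  also have "\<dots> \<le> bergman_kernel (annulus r) w / c\<^sup>2"
    using bergman_kernel_annulus_ge[OF assms w] assms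
    by (intro divide_right_mono) (simp_all add: L_def w_def)
  finally show ?thesis by (simp add: c_def w_def)
qed

end
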